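(* Let $\mathcal{H}$, $A$, $C$, $\mu$, $S$, $(\gamma_n)_{n\in\mathbb{N}}$, $(M_n)_{n\in\mathbb{N}}$, $(\zeta_n)_{n\in\mathbb{N}}$ be as in the context, and let $\boldsymbol{Z}=\operatorname{zer}(A+C)\neq\varnothing$. Let $(\alpha_n)_{n\in\mathbb{N}}$ be a sequence in $[0,1]$, let $\lambda\in\,]0,2[$, let $(x_0,x_{-1},u_0)\in\mathcal{H}^3$, and let $(x_n)_{n\in\mathbb{N}}$ be defined recursively by $$(\forall n\in\mathbb{N})\quad \begin{cases} y_n=x_n+\alpha_n(x_n-x_{n-1}),\\ p_{n+1}=(M_n+A)^{-1}\left(M_ny_n-Cy_n+u_n/\gamma_n\right),\\ u_{n+1}=(\gamma_nM_n-S)p_{n+1}-(\gamma_nM_n-S)y_n,\\ x_{n+1}=(1-\lambda)y_n+\lambda p_{n+1}.\end{cases}$$ For every $n\ge1$ define $$T_n=\gamma_nM_n-S,\qquad \nu_n=\begin{cases}\zeta_{n-1}, & \text{if } -T_n \text{ is monotone and } \lambda\ge 1,\\ 2\zeta_n+\zeta_{n-1}, & \text{otherwise,}\end{cases}$$ $$\rho_n=2-\lambda-|1-\lambda|\nu_n-\frac{\gamma_n}{2\mu}-(1+|1-\lambda|)\zeta_n,$$ $$\eta_n=(1-\alpha_n)\frac{\rho_n}{\lambda}-\lambda\zeta_{n-1},\qquad \xi_n=\alpha_n(1+\alpha_n)+\alpha_n(1-\alpha_n)\frac{\rho_n}{\lambda}.$$ Suppose that there exist an integer $N_0\ge1$ such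 that $(\alpha_n)_{n\ge N_0}$ is non-decreasing and $\epsilon\in\,]0,+\infty[$ such that $$(\forall n\ge N_0)\quad \rho_n\ge0\quad\text{and}\quad \eta_n-\xi_{n+1}\ge\epsilon.$$ Moreover, suppose that either $\lambda\in[1,2[$, or $\lambda\in\,]0,1[$ and $(\xi_n)_{n\ge N_0}$ is non-decreasing. Then $(x_n)_{n\in\mathbb{N}}$ converges weakly to a point in $\boldsymbol{Z}$.
   Context: $\mathbb{N}=\{0,1,2,\dots\}$. $\mathcal{H}$ is a real Hilbert space with inner product $\langle\cdot\mid\cdot\rangle$ and norm $\|\cdot\|$. $S\colon\mathcal{H}\to\mathcal{H}$ is a bounded linear self-adjoint strongly monotone operator (i.e. there is $a>0$ with $\langle Sx\mid x\rangle\ge a\|x\|^2$ for all $x$); $\|x\|_S=\sqrt{\langle Sx\mid x\rangle}$ and $\|x\|_{S^{-1}}=\sqrt{\langle S^{-1}x\mid x\rangle}$. An operator $T\colon\mathcal{H}\to\mathcal{H}$ is $\beta$-cocoercive with respect to $S$ ($\beta>0$) if $\langle x-y\mid Tx-Ty\rangle\ge\beta\|Tx-Ty\|_{S^{-1}}^2$ for all $x,y\in\mathcal{H}$. It is $\beta$-Lipschitz with respect to $S$ ($\beta\ge0$) if $\|Tx-Ty\|_{S^{-1}}\le\beta\|x-y\|_S$ for all $x,y\in\mathcal{H}$. It is monotone if $\langle x-y\mid Tx-Ty\rangle\ge0$ for all $x,y$. Standing assumptions: $A\colon\mathcal{H}\to2^{\mathcal{H}}$ is maximally monotone; $C\colon\mathcal{H}\to\mathcal{H}$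 is $\mu$-cocoercive with respect to $S$, with $\mu\in\,]0,+\infty[$; the solution set $\boldsymbol{Z}=\operatorname{zer}(A+C)=\{x\in\mathcal{H}: 0\in Ax+Cx\}$ is nonempty; $\underline{\gamma},\overline{\gamma}\in\,]0,+\infty[$ and $(\gamma_n)_{n\in\mathbb{N}}$ is a sequence in $[\underline{\gamma},\overline{\gamma}]$; $\varepsilon\in\,]0,1[$; for every $n\in\mathbb{N}$, $M_n\colon\mathcal{H}\to\mathcal{H}$ is a (possibly nonlinear) operator such that $\gamma_nM_n-S$ is $\zeta_n$-Lipschitz with respect to $S$, with $\zeta_n\in[0,1-\varepsilon]$. Under these assumptions $(M_n+A)^{-1}$ is single-valued and defined everywhere, so the recursion is well defined. *)

theory Defs
  imports "HOL-Analysis.Analysis"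
begin

text \<open>
  Real Hilbert spaces are types of sort \<open>{real_inner, complete_space}\<close>.  An operator
  into the power set is a function \<open>'a \<Rightarrow> 'a set\<close>; a point-valued map \<open>T\<close> is
  regarded as the set-valued operator \<open>single T\<close> when it is added to one.
\<close>

definition self_adjoint :: "('a::real_inner \<Rightarrow> 'a) \<Rightarrow> bool" where
  "self_adjoint S \<longleftrightarrow> (\<forall>x y. inner (S x) y = inner x (S y))"

text \<open>For linear maps only, as strong monotonicity is stated without differences.\<close>

definition strongly_monotone_linear :: "('a::real_inner \<Rightarrow> 'a) \<Rightarrow> bool" where
  "strongly_monotone_linear S \<longleftrightarrow> (\<exists>a>0. \<forall>x. inner (S x) x \<ge> a * (norm x)\<^sup>2)"

definition norm_wrt :: "('a::real_inner \<Rightarrow> 'a) \<Rightarrow> 'a \<Rightarrow> real" where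
  "norm_wrt S x = sqrt (inner (S x) x)"

text \<open>
  In the next two definitions \<open>S\<close> is meant to be bounded, linear, self-adjoint and strongly
  monotone.  On a Hilbert space it is then bijective, so that \<open>inv S\<close> is its genuine inverse.
\<close>

definition cocoercive_wrt :: "('a::real_inner \<Rightarrow> 'a) \<Rightarrow> real \<Rightarrow> ('a \<Rightarrow> 'a) \<Rightarrow> bool" where
  "cocoercive_wrt S \<beta> T \<longleftrightarrow>
     (\<forall>x y. inner (x - y) (T x - T y) \<ge> \<beta> * (norm_wrt (inv S) (T x - T y))\<^sup>2)"

definition lipschitz_wrt :: "('a::real_inner \<Rightarrow> 'a) \<Rightarrow> real \<Rightarrow> ('a \<Rightarrow> 'a) \<Rightarrow> bool" where
  "lipschitz_wrt S \<beta> T \<longleftrightarrow>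
     (\<forall>x y. norm_wrt (inv S) (T x - T y) \<le> \<beta> * norm_wrt S (x - y))"

definition monotone_single_valued :: "('a::real_inner \<Rightarrow> 'a) \<Rightarrow> bool" where
  "monotone_single_valued T \<longleftrightarrow> (\<forall>x y. inner (x - y) (T x - T y) \<ge> 0)"

definition monotone_op :: "('a::real_inner \<Rightarrow> 'a set) \<Rightarrow> bool" where
  "monotone_op A \<longleftrightarrow> (\<forall>x y. \<forall>u\<in>A x. \<forall>v\<in>A y. inner (x - y) (u - v) \<ge> 0)"

definition maximally_monotone_op :: "('a::real_inner \<Rightarrow> 'a set) \<Rightarrow> bool" where
  "maximally_monotone_op A \<longleftrightarrow>
     monotone_op A \<and> (\<forall>B. monotone_op B \<and> (\<forall>x. A x \<subseteq> B x) \<longrightarrow> B = A)"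

definition single :: "('a \<Rightarrow> 'b) \<Rightarrow> 'a \<Rightarrow> 'b set" where
  "single T x = {T x}"

definition sum_op :: "('a \<Rightarrow> 'b::plus set) \<Rightarrow> ('a \<Rightarrow> 'b set) \<Rightarrow> 'a \<Rightarrow> 'b set" where
  "sum_op A B x = {a + b | a b. a \<in> A x \<and> b \<in> B x}"

definition inverse_op :: "('a \<Rightarrow> 'b set) \<Rightarrow> 'b \<Rightarrow> 'a set" where
  "inverse_op A u = {x. u \<in> A x}"

definition zer :: "('a \<Rightarrow> 'b::zero set) \<Rightarrow> 'a set" where
  "zer A = {x. 0 \<in> A x}"

definition weakly_converges_to :: "(nat \<Rightarrow> 'a::real_inner) \<Rightarrow> 'a \<Rightarrow> bool" where
  "weakly_converges_to x z \<longleftrightarrow> (\<forall>v. (\<lambda>n. inner (x n) v) \<longlonglongrightarrow> inner z v)"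

text \<open>\<open>previous a x n\<close> is \<open>x (n - 1)\<close>, where the term with index \<open>-1\<close> is \<open>a\<close>.\<close>

definition previous :: "'a \<Rightarrow> (nat \<Rightarrow> 'a) \<Rightarrow> nat \<Rightarrow> 'a" where
  "previous a x n = (case n of 0 \<Rightarrow> a | Suc k \<Rightarrow> x k)"

text \<open>
  The sequences \<open>x\<close>, \<open>y\<close>, \<open>p\<close>, \<open>u\<close> are generated from \<open>(x 0, xm1, u 0)\<close>; the value \<open>p 0\<close>
  plays no role.  The value of \<open>(M n + A)\<inverse>\<close> is a set, which is a singleton under the
  hypotheses of the theorem, so the membership below is the equation defining \<open>p (n + 1)\<close>.
\<close>

definition inertial_iteration ::
  "('a::real_inner \<Rightarrow> 'a set) \<Rightarrow> ('a \<Rightarrow> 'a) \<Rightarrow> ('a \<Rightarrow> 'a) \<Rightarrow> (nat \<Rightarrow> 'a \<Rightarrow> 'a) \<Rightarrow> (nat \<Rightarrow> real) \<Rightarrow>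
   (nat \<Rightarrow> real) \<Rightarrow> real \<Rightarrow> 'a \<Rightarrow>
   (nat \<Rightarrow> 'a) \<Rightarrow> (nat \<Rightarrow> 'a) \<Rightarrow> (nat \<Rightarrow> 'a) \<Rightarrow> (nat \<Rightarrow> 'a) \<Rightarrow> bool" where
  "inertial_iteration A C S M \<gamma> \<alpha> lam xm1 x y p u \<longleftrightarrow>
     (\<forall>n. y n = x n + \<alpha> n *\<^sub>R (x n - previous xm1 x n) \<and>
          p (n + 1) \<in> inverse_op (sum_op (single (M n)) A)
                        (M n (y n) - C (y n) + (1 / \<gamma> n) *\<^sub>R u n) \<and>
          u (n + 1) = (\<gamma> n *\<^sub>R M n (p (n + 1)) - S (p (n + 1)))
                      - (\<gamma> n *\<^sub>R M n (y n) - S (y n)) \<and>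
          x (n + 1) = (1 - lam) *\<^sub>R y n + lam *\<^sub>R p (n + 1))"

end

theory Submission
  imports Defs
begin

text \<open>Write \<open>E v = \<langle>S v | v\<rangle>\<close> for the squared \<open>S\<close>-norm, \<open>D w = \<langle>S\<^sup>-\<^sup>1 w | w\<rangle>\<close> for the squared dual
  norm, \<open>q n = E (y n - p (n + 1))\<close>, and fix a zero \<open>z\<close> of \<open>A + C\<close>.

  Multiplied by \<open>\<gamma> n\<close>, the inclusion that defines \<open>p (n + 1)\<close> says that
  \<open>S (y n - p (n + 1)) - u (n + 1) + u n - \<gamma> n C (y n)\<close> belongs to \<open>\<gamma> n A (p (n + 1))\<close>.  So a step is
  a forward-backward step for the metric of \<open>S\<close>, perturbed by a difference of two consecutive
  corrections, and the kernels enter only through \<open>D (u (n + 1)) \<le> (\<zeta> n)\<^sup>2 q n\<close>.  The part of the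
  perturbation that telescopes goes into the Lyapunov function
  \<open>L n = E (x n - z) + 2 lam \<langle>x n - z | u n\<rangle> + lam (1 + \<bar>1 - lam\<bar>) \<zeta> (n - 1) q (n - 1)\<close>; the rest
  is absorbed by Young's inequality, and \<open>\<rho> n\<close> is what remains of the coefficient of \<open>q n\<close>.  With
  \<open>lam\<^sup>2 q n = E (x (n + 1) - y n)\<close> and the definition of \<open>y n\<close> this becomes the inequality of
  \<open>lyapunov_step\<close>, where \<open>\<phi> n = E (x n - z)\<close> and \<open>d n = E (x n - x (n - 1))\<close>:
  \<open>L (n + 1) \<le> L n + \<alpha> n (\<phi> n - \<phi> (n - 1)) + \<xi> n d n - \<eta> n d (n + 1)\<close>.

  Since \<open>\<alpha>\<close> is non-decreasing and \<open>\<eta> n - \<xi> (n + 1) \<ge> \<delta>\<close>, the quantity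
  \<open>\<Theta> n = L n - \<alpha> n \<phi> (n - 1) + \<xi> n d n\<close> loses at least \<open>\<delta> d (n + 1)\<close> at each step.  To see that it
  is bounded below one needs \<open>L n \<ge> (\<alpha> n + \<kappa>) \<phi> n\<close> with a fixed \<open>\<kappa> > 0\<close>
  (\<open>inertial_lyapunov_decrease\<close>); this margin is hidden in the hypothesis on \<open>\<eta>\<close> and \<open>\<xi>\<close>, and
  the monotonicity of \<open>\<xi>\<close> serves to extract it when \<open>lam < 1\<close>
  (\<open>inertial_margin_overrelaxed\<close>, \<open>inertial_margin_underrelaxed\<close>).  It follows that \<open>d\<close>, \<open>q\<close> and \<open>u\<close>
  vanish in the limit and that \<open>\<phi>\<close> converges for every zero \<open>z\<close>
  (\<open>inertial_sequence_convergent\<close>).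

  Weak convergence is then an argument in the style of Opial, in which the intersection \<open>K\<close> of the
  closed convex hulls of the tails of \<open>p\<close> takes the place of the set of weak cluster points.  That
  \<open>K\<close> is nonempty is an elementary fact about nested closed convex sets, so that no weak
  compactness is involved.  That \<open>K\<close> consists of zeros (\<open>tail_hull_core_zer_sum\<close>) and that \<open>K\<close> is
  a single point which is the weak limit (\<open>opial_tail_hull_core\<close>) both follow from inequalities
  that are affine in the iterates, and these pass to closed convex hulls.\<close>


section \<open>The asymptotic convex hull of a bounded sequence\<close>

text \<open>Near-minimisers \<open>m k\<close> of the norm over \<open>K k\<close> form a Cauchy sequence: the midpoint of \<open>m j\<close> and
  \<open>m k\<close> lies in the larger of the two sets, so the parallelogram identity bounds
  \<open>norm (m j - m k)\<close> by the growth of the infima \<open>R\<close>, which is bounded because \<open>K 0\<close> is.\<close>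

lemma nested_closed_convex_Inter_nonempty:
  fixes K :: "nat \<Rightarrow> 'a::{real_inner, complete_space} set"
  assumes closed: "\<And>k. closed (K k)" and conv: "\<And>k. convex (K k)"
    and ne: "\<And>k. K k \<noteq> {}" and dec: "decseq K" and bdd: "bounded (K 0)"
  shows "(\<Inter>k. K k) \<noteq> {}"
proof -
  define R where "R k = (INF v\<in>K k. (norm v)\<^sup>2)" for k
  have bb: "bdd_below ((\<lambda>v. (norm v)\<^sup>2) ` K k)" for k
    by (rule bdd_belowI[of _ 0]) auto
  have sub: "K j \<subseteq> K k" if "k \<le> j" for j k
    using dec that by (auto simp: decseq_def)
  have R_le: "R k \<le> (norm v)\<^sup>2" if "v \<in> K k" for k v
    unfolding R_def by (rule cINF_lower[OF bb that])
  have "\<exists>v\<in>K k. (norm v)\<^sup>2 < R k + 1 / real (Suc k)" for k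
  proof -
    have "R k < R k + 1 / real (Suc k)" by simp
    then show ?thesis
      using cINF_less_iff[OF ne bb] unfolding R_def by metis
  qed
  then obtain m where m: "\<And>k. m k \<in> K k" "\<And>k. (norm (m k))\<^sup>2 < R k + 1 / real (Suc k)"
    by metis
  obtain B where B: "\<And>v. v \<in> K 0 \<Longrightarrow> norm v \<le> B"
    using bdd by (auto simp: bounded_iff)
  have "incseq R"
    unfolding incseq_def R_def by (auto intro!: cINF_superset_mono ne bb sub)
  moreover have "R k \<le> B\<^sup>2" for k
    using R_le[OF m(1)[of k]] power_mono[OF B[of "m k"], of 2] m(1)[of k] sub[of 0 k] by force
  ultimately have "convergent R"
    by (metis incseq_convergent convergent_def)
  then have cR: "Cauchy R" by (rule convergent_Cauchy)
  have gap: "(norm (m j - m k))\<^sup>2 \<le> 2 * (R j - R k) + 4 / real (Suc k)" if "k \<le> j" for j k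
  proof -
    have "(1/2) *\<^sub>R m j + (1/2) *\<^sub>R m k \<in> K k"
      using m(1)[of j] m(1)[of k] sub[OF that] by (intro convexD[OF conv]) auto
    from R_le[OF this] have "4 * R k \<le> (norm (m j + m k))\<^sup>2"
      by (simp add: scaleR_add_right[symmetric] power_divide)
    moreover have "(norm (m j - m k))\<^sup>2 = 2 * (norm (m j))\<^sup>2 + 2 * (norm (m k))\<^sup>2 - (norm (m j + m k))\<^sup>2"
      by (simp add: power2_norm_eq_inner inner_simps inner_commute)
    moreover have "1 / real (Suc j) \<le> 1 / real (Suc k)"
      using that by (simp add: frac_le)
    ultimately show ?thesis using m(2)[of j] m(2)[of k] by simp
  qed
  have "Cauchy m"
  proof (rule metric_CauchyI)
    fix e :: real assume e: "e > 0"
    then have "e\<^sup>2 / 4 > 0" by simp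
    from metric_CauchyD[OF cR this] obtain N1 where
      N1: "\<And>i j. i \<ge> N1 \<Longrightarrow> j \<ge> N1 \<Longrightarrow> dist (R i) (R j) < e\<^sup>2 / 4" by blast
    obtain N2 where N2: "8 / e\<^sup>2 < real N2" using reals_Archimedean2 by blast
    have le: "dist (m j) (m k) < e" if "k \<ge> max N1 N2" "k \<le> j" for j k
    proof -
      have "R j - R k < e\<^sup>2 / 4" using N1[of j k] that unfolding dist_real_def by linarith
      moreover have "8 / e\<^sup>2 < real (Suc k)" using N2 that by auto
      then have "4 / real (Suc k) < e\<^sup>2 / 2"
        using e by (simp add: field_simps)
      ultimately have "2 * (R j - R k) + 4 / real (Suc k) < e\<^sup>2"
        by (simp del: of_nat_Suc)
      with gap[OF that(2)] have "(norm (m j - m k))\<^sup>2 < e\<^sup>2"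
        by (rule order_le_less_trans)
      then show ?thesis using e by (simp add: dist_norm power_less_imp_less_base)
    qed
    have "dist (m i) (m j) < e" if "i \<ge> max N1 N2" "j \<ge> max N1 N2" for i j
      using le[of i j] le[of j i] that by (cases "i \<le> j") (auto simp: dist_commute)
    then show "\<exists>M. \<forall>i\<ge>M. \<forall>j\<ge>M. dist (m i) (m j) < e" by blast
  qed
  then obtain l where l: "m \<longlonglongrightarrow> l" using Cauchy_convergent convergent_def by blast
  have "l \<in> K k" for k
  proof (rule closed_sequentially[OF closed])
    show "(\<lambda>n. m (n + k)) \<longlonglongrightarrow> l" using l by (rule LIMSEQ_ignore_initial_segment)
    show "\<And>n. m (n + k) \<in> K k" using m(1) sub[of k] by (meson le_add2 subsetD)
  qed
  then have "l \<in> (\<Inter>k. K k)" by simp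
  then show ?thesis by (metis empty_iff)
qed

text \<open>The index set \<open>I\<close> selects a subsequence when it is infinite.  In place of the weak cluster
  points of \<open>x\<close> along \<open>I\<close> this is a convex set that contains them, so that it is nonempty by an
  elementary argument and still controlled by the affine inequalities that \<open>x\<close> satisfies.\<close>

definition tail_hull_core :: "(nat \<Rightarrow> 'a::real_inner) \<Rightarrow> nat set \<Rightarrow> 'a set" where
  "tail_hull_core x I = (\<Inter>k. closure (convex hull (x ` (I \<inter> {k..}))))"

lemma tail_hull_core_nonempty:
  fixes x :: "nat \<Rightarrow> 'a::{real_inner, complete_space}"
  assumes "infinite I" "bounded (range x)"
  shows "tail_hull_core x I \<noteq> {}"
  unfolding tail_hull_core_def
proof (rule nested_closed_convex_Inter_nonempty)
  show "decseq (\<lambda>k. closure (convex hull x ` (I \<inter> {k..})))"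
    unfolding decseq_def by (intro allI impI closure_mono hull_mono) auto
  show "bounded (closure (convex hull x ` (I \<inter> {0..})))"
    by (intro bounded_closure bounded_convex_hull bounded_subset[OF assms(2)]) auto
  fix k
  have "I \<inter> {k..} \<noteq> {}" using assms(1) unfolding infinite_nat_iff_unbounded_le by blast
  then show "closure (convex hull x ` (I \<inter> {k..})) \<noteq> {}" by simp
qed (auto intro: convex_closure)

lemma tail_hull_core_subset: "tail_hull_core x I \<subseteq> tail_hull_core x UNIV"
  unfolding tail_hull_core_def
  by (intro INF_mono) (auto intro!: closure_mono hull_mono)

text \<open>Half-spaces are closed and convex, so an asymptotic lower bound for a linear functional along
  the sequence holds on the core.\<close>

lemma tail_hull_core_inner_ge:
  assumes m: "m \<in> tail_hull_core x I" and g: "g \<longlonglongrightarrow> c"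
    and ge: "\<And>n. n \<in> I \<Longrightarrow> g n \<le> inner (x n) w"
  shows "c \<le> inner m w"
proof (rule field_le_epsilon)
  fix e :: real assume "e > 0"
  with g have "\<forall>\<^sub>F n in sequentially. c - e < g n" by (auto intro: order_tendstoD)
  then obtain k where k: "\<And>n. n \<ge> k \<Longrightarrow> c - e < g n" by (auto simp: eventually_sequentially)
  have "x ` (I \<inter> {k..}) \<subseteq> {v. c - e \<le> inner w v}"
    using ge k by (fastforce simp: inner_commute)
  then have "closure (convex hull (x ` (I \<inter> {k..}))) \<subseteq> {v. c - e \<le> inner w v}"
    using convex_halfspace_ge closed_halfspace_ge by (intro closure_minimal hull_minimal) auto
  then show "c \<le> inner m w + e"
    using m by (auto simp: tail_hull_core_def inner_commute)
qed

lemma inner_tendsto_zero_bounded: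
  fixes v w :: "nat \<Rightarrow> 'a::real_inner"
  assumes "bounded (range v)" "w \<longlonglongrightarrow> 0"
  shows "(\<lambda>n. inner (v n) (w n)) \<longlonglongrightarrow> 0"
proof -
  obtain B where B: "\<And>n. norm (v n) \<le> B" using assms(1) by (auto simp: bounded_iff)
  show ?thesis
  proof (rule Lim_null_comparison)
    have "norm (inner (v n) (w n)) \<le> B * norm (w n)" for n
    proof -
      have "norm (inner (v n) (w n)) \<le> norm (v n) * norm (w n)"
        by (simp add: Cauchy_Schwarz_ineq2)
      also have "\<dots> \<le> B * norm (w n)" using B by (intro mult_right_mono) auto
      finally show ?thesis .
    qed
    then show "\<forall>\<^sub>F n in sequentially. norm (inner (v n) (w n)) \<le> B * norm (w n)" by simp
    show "(\<lambda>n. B * norm (w n)) \<longlonglongrightarrow> 0" by (intro tendsto_mult_right_zero tendsto_norm_zero assms(2))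
  qed
qed

lemma bounded_scaleR_tendsto_zero:
  fixes w :: "nat \<Rightarrow> 'b::real_normed_vector"
  assumes "\<And>n. \<bar>c n\<bar> \<le> B" "w \<longlonglongrightarrow> 0"
  shows "(\<lambda>n. c n *\<^sub>R w n) \<longlonglongrightarrow> 0"
proof (rule Lim_null_comparison)
  show "\<forall>\<^sub>F n in sequentially. norm (c n *\<^sub>R w n) \<le> B * norm (w n)"
    using assms(1) by (intro always_eventually allI) (simp add: mult_right_mono)
  show "(\<lambda>n. B * norm (w n)) \<longlonglongrightarrow> 0"
    by (intro tendsto_mult_right_zero tendsto_norm_zero assms(2))
qed


section \<open>Asymptotic convex hulls and zeros of monotone operators\<close>

text \<open>Otherwise adding \<open>(m, a)\<close> to the graph would give a proper monotone extension.\<close>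

lemma maximally_monotone_opD:
  assumes A: "maximally_monotone_op A" and ge: "\<And>v w. w \<in> A v \<Longrightarrow> 0 \<le> inner (m - v) (a - w)"
  shows "a \<in> A m"
proof -
  define B where "B v = (if v = m then insert a (A v) else A v)" for v
  have "0 \<le> inner (v - m) (w - a)" if "w \<in> A v" for v w
    using ge[OF that] by (metis inner_minus_left inner_minus_right minus_diff_eq minus_minus)
  then have "monotone_op B"
    using A ge by (auto simp: monotone_op_def maximally_monotone_op_def B_def)
  moreover have "\<forall>x. A x \<subseteq> B x" by (auto simp: B_def)
  ultimately have "B = A" using A by (auto simp: maximally_monotone_op_def)
  then have "A m = B m" by simp
  then show ?thesis unfolding B_def by auto
qed

text \<open>If the values converge strongly, the monotonicity inequality against a given element
  \<open>(v, w)\<close> of the graph is affine in \<open>x n\<close> up to an error that vanishes, so it holds on the core.\<close>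

lemma tail_hull_core_maximally_monotone:
  assumes A: "maximally_monotone_op A" and a: "\<And>n. a n \<in> A (x n)" "a \<longlonglongrightarrow> l"
    and bdd: "bounded (range x)" and m: "m \<in> tail_hull_core x UNIV"
  shows "l \<in> A m"
proof (rule maximally_monotone_opD[OF A])
  fix v w assume w: "w \<in> A v"
  have "(\<lambda>n. inner (x n) (l - a n)) \<longlonglongrightarrow> 0"
    using bdd a(2) tendsto_diff[OF tendsto_const[of l] a(2)] by (intro inner_tendsto_zero_bounded) auto
  then have lim: "(\<lambda>n. inner (x n) (l - a n) + inner v (a n - w)) \<longlonglongrightarrow> 0 + inner v (l - w)"
    using a(2) by (intro tendsto_intros)
  have "inner (x n) (l - a n) + inner v (a n - w) \<le> inner (x n) (l - w)" for n
  proof -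
    have "0 \<le> inner (x n - v) (a n - w)"
      using A a(1)[of n] w by (auto simp: maximally_monotone_op_def monotone_op_def)
    then show ?thesis by (simp add: inner_simps)
  qed
  from tail_hull_core_inner_ge[OF m lim this]
  show "0 \<le> inner (m - v) (l - w)" by (simp add: inner_simps)
qed

text \<open>Cocoercivity gives more than monotonicity of \<open>A + C\<close>: a vanishing residual \<open>a n + C (x n)\<close> forces
  \<open>C (x n)\<close> to converge strongly to \<open>C z\<close>, the common value of \<open>C\<close> at all zeros.  Then \<open>a\<close>
  converges strongly as well and \<open>A\<close> can be treated separately from \<open>C\<close>.\<close>

lemma tail_hull_core_zer_sum:
  fixes A :: "'a::real_inner \<Rightarrow> 'a set" and C :: "'a \<Rightarrow> 'a"
  assumes A: "maximally_monotone_op A" and "\<beta> > 0"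
    and coco: "\<And>v w. \<beta> * (norm (C v - C w))\<^sup>2 \<le> inner (v - w) (C v - C w)"
    and z: "z \<in> zer (sum_op A (single C))"
    and a: "\<And>n. a n \<in> A (x n)" "(\<lambda>n. a n + C (x n)) \<longlonglongrightarrow> 0" and bdd: "bounded (range x)"
  shows "tail_hull_core x UNIV \<subseteq> zer (sum_op A (single C))"
proof
  have zA: "- C z \<in> A z"
  proof -
    obtain b where "b \<in> A z" "0 = b + C z" using z unfolding zer_def sum_op_def single_def by blast
    then show ?thesis by (metis eq_neg_iff_add_eq_0)
  qed
  have bdd': "bounded (range (\<lambda>n. x n - v))" for v
    using bounded_translation[OF bdd, of "- v"] by (simp add: image_image)
  have "norm ((norm (C (x n) - C z))\<^sup>2) \<le> inner (x n - z) (a n + C (x n)) / \<beta>" for n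
  proof -
    have "0 \<le> inner (x n - z) (a n - - C z)"
      using A a(1)[of n] zA unfolding maximally_monotone_op_def monotone_op_def by blast
    also have "\<dots> = inner (x n - z) (a n + C (x n)) - inner (x n - z) (C (x n) - C z)"
      by (simp add: inner_diff_right inner_add_right)
    finally have "\<beta> * (norm (C (x n) - C z))\<^sup>2 \<le> inner (x n - z) (a n + C (x n))"
      using coco[of "x n" z] by linarith
    then show ?thesis using \<open>\<beta> > 0\<close> by (simp add: pos_le_divide_eq mult.commute)
  qed
  moreover have "(\<lambda>n. inner (x n - z) (a n + C (x n)) / \<beta>) \<longlonglongrightarrow> 0"
    by (intro tendsto_divide_zero inner_tendsto_zero_bounded bdd' a(2))
  ultimately have "(\<lambda>n. (norm (C (x n) - C z))\<^sup>2) \<longlonglongrightarrow> 0"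
    by (intro Lim_null_comparison[of "\<lambda>n. (norm (C (x n) - C z))\<^sup>2"
          "\<lambda>n. inner (x n - z) (a n + C (x n)) / \<beta>"]) auto
  then have Cdiff: "(\<lambda>n. C (x n) - C z) \<longlonglongrightarrow> 0"
    by (simp add: tendsto_norm_zero_iff power_tendsto_0_iff)
  then have Clim: "(\<lambda>n. C (x n)) \<longlonglongrightarrow> C z" by (simp add: LIM_zero_iff)
  from tendsto_diff[OF a(2) Clim] have "a \<longlonglongrightarrow> - C z" by simp
  fix m assume m: "m \<in> tail_hull_core x UNIV"
  from tail_hull_core_maximally_monotone[OF A a(1) \<open>a \<longlonglongrightarrow> - C z\<close> bdd m] have "- C z \<in> A m" .
  \<comment> \<open>With \<open>C (x n)\<close> replaced by its limit in one factor, the cocoercivity inequality between \<open>x n\<close> and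
    \<open>m\<close> is affine in \<open>x n\<close>; on the core, hence at \<open>m\<close> itself, it reads \<open>\<beta> * (norm (C z - C m))\<^sup>2 \<le> 0\<close>.\<close>
  moreover have "C z = C m"
  proof -
    define w where "w = C z - C m"
    have g: "(\<lambda>n. \<beta> * (norm (C (x n) - C m))\<^sup>2 - inner (x n - m) (C (x n) - C z) + inner m w)
        \<longlonglongrightarrow> \<beta> * (norm (C z - C m))\<^sup>2 - 0 + inner m w"
      by (intro tendsto_intros Clim inner_tendsto_zero_bounded bdd' Cdiff)
    have "\<beta> * (norm (C (x n) - C m))\<^sup>2 - inner (x n - m) (C (x n) - C z) + inner m w \<le> inner (x n) w" for n
      using coco[of "x n" m] by (simp add: w_def inner_diff_left inner_diff_right)
    from tail_hull_core_inner_ge[OF m g this] have "\<beta> * (norm (C z - C m))\<^sup>2 \<le> 0" by simp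
    then show ?thesis using \<open>\<beta> > 0\<close> by (simp add: mult_le_0_iff)
  qed
  ultimately have "- C m + C m \<in> sum_op A (single C) m"
    unfolding sum_op_def single_def by force
  then show "m \<in> zer (sum_op A (single C))" by (simp add: zer_def)
qed


section \<open>The inner product defined by a strongly positive operator\<close>

locale strongly_positive_operator =
  fixes S :: "'a::{real_inner, complete_space} \<Rightarrow> 'a"
  assumes bounded_linear_S: "bounded_linear S"
    and self_adjoint_S: "self_adjoint S"
    and strongly_monotone_S: "strongly_monotone_linear S"
begin

sublocale S: bounded_linear S by (rule bounded_linear_S)

abbreviation energy :: "'a \<Rightarrow> real" where "energy v \<equiv> inner (S v) v"
abbreviation dual_energy :: "'a \<Rightarrow> real" where "dual_energy v \<equiv> inner (inv S v) v"

lemma inner_S_commute: "inner (S v) w = inner (S w) v"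
  using self_adjoint_S by (simp add: self_adjoint_def inner_commute)

lemma energy_lower_bound:
  obtains a where "a > 0" "\<And>v. a * (norm v)\<^sup>2 \<le> energy v"
  using strongly_monotone_S by (auto simp: strongly_monotone_linear_def)

lemma energy_nonneg [simp]: "0 \<le> energy v"
proof -
  obtain a where "a > 0" "a * (norm v)\<^sup>2 \<le> energy v" using energy_lower_bound by blast
  then show ?thesis by (smt (verit) mult_nonneg_nonneg zero_le_power2)
qed

text \<open>To solve \<open>S v = b\<close>, the map \<open>v \<mapsto> v - t (S v - b)\<close> is a contraction for a suitable step \<open>t\<close>.\<close>

lemma bij_S: "bij S"
proof (rule bijI)
  obtain a where a: "a > 0" "\<And>v. a * (norm v)\<^sup>2 \<le> energy v" using energy_lower_bound by blast
  have S0: "S v = 0 \<Longrightarrow> v = 0" for v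
    using a(1) a(2)[of v] by (auto simp: mult_le_0_iff)
  show "inj S"
  proof (rule injI)
    fix v w assume "S v = S w"
    then have "S (v - w) = 0" by (simp add: S.diff)
    then show "v = w" using S0 by force
  qed
  obtain K where K: "K > 0" "\<And>v. norm (S v) \<le> norm v * K" using S.pos_bounded by blast
  \<comment> \<open>The squared contraction constant is \<open>1 - 2 * t * a + t\<^sup>2 * k\<^sup>2\<close>, and \<open>t = a / k\<^sup>2\<close> minimises it.
    The bound \<open>K\<close> is enlarged to \<open>k\<close> so that its minimum \<open>1 - a\<^sup>2 / k\<^sup>2\<close> is positive.\<close>
  define k where "k = K + a"
  have k: "k > 0" "a < k" using K(1) a(1) by (simp_all add: k_def)
  have Sk: "norm (S v) \<le> norm v * k" for v
  proof -
    have "norm v * K \<le> norm v * k" using a(1) by (intro mult_left_mono) (auto simp: k_def)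
    with K(2)[of v] show ?thesis by (rule order_trans)
  qed
  define t where "t = a / k\<^sup>2"
  show "surj S"
  proof (rule surjI)
    fix b
    define f where "f v = v - t *\<^sub>R (S v - b)" for v
    define c where "c = sqrt (1 - a\<^sup>2 / k\<^sup>2)"
    have "a\<^sup>2 < k\<^sup>2" "0 < a\<^sup>2" using k a(1) by (simp_all add: power_strict_mono)
    then have "0 < a\<^sup>2 / k\<^sup>2" "a\<^sup>2 / k\<^sup>2 < 1" using k by (simp_all add: divide_less_eq)
    then have c: "0 \<le> c" "c < 1" "c\<^sup>2 = 1 - a\<^sup>2 / k\<^sup>2" by (auto simp: c_def)
    have "dist (f v) (f w) \<le> c * dist v w" for v w
    proof -
      define d where "d = v - w"
      have "f v - f w = d - t *\<^sub>R S d" by (simp add: f_def d_def S.diff algebra_simps)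
      then have "(norm (f v - f w))\<^sup>2 = (norm (d - t *\<^sub>R S d))\<^sup>2" by simp
      also have "\<dots> = (norm d)\<^sup>2 - 2 * t * energy d + t\<^sup>2 * (norm (S d))\<^sup>2"
        unfolding power2_norm_eq_inner power2_eq_square[of t] inner_diff_left inner_diff_right
        by (simp add: inner_commute)
      also have "\<dots> \<le> (norm d)\<^sup>2 - 2 * t * (a * (norm d)\<^sup>2) + t\<^sup>2 * (norm d * k)\<^sup>2"
        using a k(1) power_mono[OF Sk[of d], of 2]
        by (intro add_mono diff_mono mult_left_mono) (auto simp: t_def)
      also have "\<dots> = (1 - 2 * t * a + (t * k)\<^sup>2) * (norm d)\<^sup>2"
        by (simp add: power_mult_distrib algebra_simps)
      also have "1 - 2 * t * a + (t * k)\<^sup>2 = c\<^sup>2"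
        unfolding c(3) t_def using k(1) by (simp add: power2_eq_square)
      also have "c\<^sup>2 * (norm d)\<^sup>2 = (c * norm d)\<^sup>2" by (simp add: power_mult_distrib)
      finally have "norm (f v - f w) \<le> c * norm d"
        by (rule power2_le_imp_le) (use c(1) in simp)
      then show ?thesis by (simp add: dist_norm d_def)
    qed
    then obtain v where "f v = v" using banach_fix_type[OF c(1,2), of f] by blast
    then have "t *\<^sub>R (S v - b) = 0" by (simp add: f_def)
    moreover have "t \<noteq> 0" using a(1) k(1) by (simp add: t_def)
    ultimately have "S v = b" by simp
    then show "S (inv S b) = b" by (metis f_inv_into_f rangeI)
  qed
qed

lemma S_inv [simp]: "S (inv S v) = v"
  using bij_S by (simp add: bij_is_surj surj_f_inv_f)

lemma dual_energy_eq: "dual_energy v = energy (inv S v)"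
  by (simp add: inner_commute)

lemma dual_energy_nonneg [simp]: "0 \<le> dual_energy v"
  unfolding dual_energy_eq by (rule energy_nonneg)

lemma norm_wrt_S_squared: "(norm_wrt S v)\<^sup>2 = energy v"
  by (simp add: norm_wrt_def)

lemma norm_wrt_inv_S_squared: "(norm_wrt (inv S) v)\<^sup>2 = dual_energy v"
  by (simp add: norm_wrt_def)

lemma norm_squared_le_dual_energy:
  obtains B where "B > 0" "\<And>v. (norm v)\<^sup>2 \<le> B * dual_energy v"
proof -
  obtain a where a: "a > 0" "\<And>v. a * (norm v)\<^sup>2 \<le> energy v" using energy_lower_bound by blast
  obtain K where K: "K > 0" "\<And>v. norm (S v) \<le> norm v * K" using S.pos_bounded by blast
  have "(norm v)\<^sup>2 \<le> (K\<^sup>2 / a) * dual_energy v" for v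
  proof -
    have "(norm v)\<^sup>2 \<le> (norm (inv S v) * K)\<^sup>2"
      using K(2)[of "inv S v"] by (simp add: power_mono)
    also have "\<dots> = (K\<^sup>2 / a) * (a * (norm (inv S v))\<^sup>2)"
      using a(1) by (simp add: power_mult_distrib)
    also have "\<dots> \<le> (K\<^sup>2 / a) * dual_energy v"
      using a(1) a(2)[of "inv S v"] by (intro mult_left_mono) (auto simp: inner_commute)
    finally show ?thesis .
  qed
  then show ?thesis using that[of "K\<^sup>2 / a"] a(1) K(1) by auto
qed

lemma energy_diff: "energy (v - w) = energy v - 2 * inner (S v) w + energy w"
  using inner_S_commute[of v w] by (simp add: S.diff inner_simps)

lemma energy_scaleR: "energy (r *\<^sub>R v) = r\<^sup>2 * energy v"
  by (simp add: S.scaleR power2_eq_square)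

lemma energy_add: "energy (v + w) = energy v + 2 * inner (S v) w + energy w"
  using inner_S_commute[of v w] by (simp add: S.add inner_simps)

text \<open>With \<open>s = S\<^sup>-\<^sup>1 w\<close> the pairing \<open>\<langle>v | w\<rangle>\<close> is \<open>\<langle>S v | s\<rangle>\<close>, and the inequality is \<open>0 \<le> E (c v - s)\<close>.\<close>

lemma young:
  assumes "c > 0"
  shows "2 * \<bar>inner v w\<bar> \<le> c * energy v + dual_energy w / c"
proof -
  have *: "2 * inner v w \<le> c * energy v + dual_energy w / c" for v
  proof -
    define s where "s = inv S w"
    have w: "w = S s" by (simp add: s_def)
    have "0 \<le> energy (c *\<^sub>R v - s)" by simp
    also have "\<dots> = c * (c * energy v - 2 * inner v w) + inner s w"
      unfolding energy_diff energy_scaleR S.scaleR w using inner_S_commute[of v s]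
      by (simp add: inner_commute power2_eq_square algebra_simps)
    finally show ?thesis using assms by (simp add: s_def[symmetric] field_simps)
  qed
  show ?thesis using *[of v] *[of "- v"] by (simp add: S.neg abs_if)
qed

text \<open>The form in which the Lipschitz bound of a correction is used: linear in \<open>\<zeta>\<close>, also for
  \<open>\<zeta> = 0\<close>, where \<open>w\<close> vanishes.\<close>

lemma young_lipschitz:
  assumes "c > 0" "0 \<le> \<zeta>" "0 \<le> q" "dual_energy w \<le> \<zeta>\<^sup>2 * q"
  shows "2 * \<bar>inner v w\<bar> \<le> \<zeta> * (c * energy v + q / c)"
proof (cases "\<zeta> = 0")
  case True
  obtain B where "B > 0" "(norm w)\<^sup>2 \<le> B * dual_energy w" using norm_squared_le_dual_energy by blast
  then have "w = 0" using assms(4) True dual_energy_nonneg[of w] by auto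
  then show ?thesis using True by simp
next
  case False
  then have z: "\<zeta> > 0" using assms by simp
  have "2 * \<bar>inner v w\<bar> \<le> (\<zeta> * c) * energy v + dual_energy w / (\<zeta> * c)"
    using young[of "\<zeta> * c"] z assms by simp
  also have "\<dots> \<le> (\<zeta> * c) * energy v + (\<zeta>\<^sup>2 * q) / (\<zeta> * c)"
    using assms z by (intro add_mono divide_right_mono) auto
  also have "(\<zeta>\<^sup>2 * q) / (\<zeta> * c) = \<zeta> * (q / c)"
    using z by (simp add: power2_eq_square)
  finally show ?thesis by (simp add: distrib_left mult.assoc)
qed

lemma tendsto_zero_iff_energy:
  "w \<longlonglongrightarrow> 0 \<longleftrightarrow> (\<lambda>n. energy (w n)) \<longlonglongrightarrow> 0"
proof
  assume w: "w \<longlonglongrightarrow> 0"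
  have "(\<lambda>n. inner (S (w n)) (w n)) \<longlonglongrightarrow> inner (S 0) 0"
    using w by (intro tendsto_intros S.tendsto)
  then show "(\<lambda>n. energy (w n)) \<longlonglongrightarrow> 0" by simp
next
  assume e: "(\<lambda>n. energy (w n)) \<longlonglongrightarrow> 0"
  obtain a where a: "a > 0" "\<And>v. a * (norm v)\<^sup>2 \<le> energy v" using energy_lower_bound by blast
  have "norm (w n) \<le> sqrt (energy (w n) / a)" for n
    using a(1) a(2)[of "w n"] by (intro real_le_rsqrt) (simp add: field_simps)
  moreover have "(\<lambda>n. sqrt (energy (w n) / a)) \<longlonglongrightarrow> sqrt (0 / a)"
    using a(1) e by (intro tendsto_intros) auto
  ultimately show "w \<longlonglongrightarrow> 0"
    by (intro Lim_null_comparison[of w "\<lambda>n. sqrt (energy (w n) / a)"]) auto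
qed

lemma bounded_if_energy_bounded:
  assumes "Bseq (\<lambda>n. energy (w n))"
  shows "bounded (range w)"
proof -
  obtain B where B: "\<And>n. energy (w n) \<le> B"
    using assms unfolding Bseq_def by (force simp: abs_le_iff)
  obtain a where a: "a > 0" "\<And>v. a * (norm v)\<^sup>2 \<le> energy v" using energy_lower_bound by blast
  have "norm (w n) \<le> sqrt (B / a)" for n
  proof (rule real_le_rsqrt)
    show "(norm (w n))\<^sup>2 \<le> B / a"
      using a(1) order_trans[OF a(2)[of "w n"] B[of n]] by (simp add: field_simps)
  qed
  then show ?thesis by (auto simp: bounded_iff)
qed

lemma energy_perturbation:
  assumes "bounded (range v)" "w \<longlonglongrightarrow> 0"
  shows "(\<lambda>n. energy (v n + w n) - energy (v n)) \<longlonglongrightarrow> 0"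
proof -
  have "(\<lambda>n. S (w n)) \<longlonglongrightarrow> 0" using S.tendsto[OF assms(2)] by simp
  from inner_tendsto_zero_bounded[OF assms(1) this]
  have "(\<lambda>n. 2 * inner (v n) (S (w n)) + energy (w n)) \<longlonglongrightarrow> 2 * 0 + 0"
    using assms(2)[unfolded tendsto_zero_iff_energy] by (intro tendsto_add tendsto_mult tendsto_const)
  moreover have "energy (v n + w n) - energy (v n) = 2 * inner (v n) (S (w n)) + energy (w n)" for n
    unfolding energy_add using inner_S_commute[of "v n" "w n"] inner_commute[of "v n" "S (w n)"] by simp
  ultimately show ?thesis by simp
qed


section \<open>Weak convergence from convergence of distances\<close>

text \<open>For \<open>z1\<close> and \<open>z2\<close> in \<open>Z\<close>, \<open>energy (x n - z1) - energy (x n - z2)\<close> is affine in \<open>x n\<close>; as it converges, the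
  functional \<open>\<langle>- | S (z2 - z1)\<rangle>\<close> is constant on the core, and if \<open>z1\<close> and \<open>z2\<close> lie there themselves
  they coincide.  If \<open>x\<close> did not converge weakly to the unique point of the core, some half-space that
  misses this point would contain infinitely many terms, and the core of that subsequence would
  provide a second point.\<close>

lemma opial_tail_hull_core:
  fixes x :: "nat \<Rightarrow> 'a"
  assumes conv: "\<And>z. z \<in> Z \<Longrightarrow> convergent (\<lambda>n. energy (x n - z))"
    and core: "tail_hull_core x UNIV \<subseteq> Z" and bdd: "bounded (range x)"
  shows "\<exists>z\<in>Z. weakly_converges_to x z"
proof -
  obtain z1 where z1: "z1 \<in> tail_hull_core x UNIV"
    using tail_hull_core_nonempty[OF infinite_UNIV_nat bdd] by blast
  have unique: "z2 = z1" if z2: "z2 \<in> tail_hull_core x UNIV" for z2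
  proof -
    have "convergent (\<lambda>n. (energy (x n - z1) - energy (x n - z2)) + (energy z2 - energy z1))"
      using conv core z1 z2 by (intro convergent_add convergent_diff convergent_const) auto
    moreover have "energy (x n - z1) - energy (x n - z2) + (energy z2 - energy z1)
        = 2 * inner (x n) (S (z2 - z1))" for n
      using inner_S_commute[of "x n" z1] inner_S_commute[of "x n" z2]
      by (simp add: energy_diff S.diff inner_diff_right inner_commute)
    ultimately have "convergent (\<lambda>n. inner (x n) (S (z2 - z1)))"
      using convergent_mult_const_iff[of 2 "\<lambda>n. inner (x n) (S (z2 - z1))"] by simp
    then obtain l where l: "(\<lambda>n. inner (x n) (S (z2 - z1))) \<longlonglongrightarrow> l" by (auto simp: convergent_def)
    have "inner z (S (z2 - z1)) = l" if z: "z \<in> tail_hull_core x UNIV" for z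
    proof (rule antisym)
      show "l \<le> inner z (S (z2 - z1))" using tail_hull_core_inner_ge[OF z l] by simp
      have "- l \<le> inner z (- S (z2 - z1))"
        by (rule tail_hull_core_inner_ge[OF z tendsto_minus[OF l]]) simp
      then show "inner z (S (z2 - z1)) \<le> l" by simp
    qed
    then have "energy (z2 - z1) = 0"
      using z1 z2 by (metis inner_commute inner_diff_left cancel_comm_monoid_add_class.diff_cancel)
    moreover obtain a where "a > 0" "a * (norm (z2 - z1))\<^sup>2 \<le> energy (z2 - z1)"
      using energy_lower_bound by blast
    ultimately show ?thesis by (auto simp: mult_le_0_iff)
  qed
  have upper: "\<forall>\<^sub>F n in sequentially. inner (x n) v < inner z1 v + e" if e: "e > 0" for v e
  proof (rule ccontr)
    define I where "I = {n. inner z1 v + e \<le> inner (x n) v}"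
    assume "\<not> ?thesis"
    then have "infinite I"
      unfolding eventually_sequentially infinite_nat_iff_unbounded_le I_def by (auto simp: not_less)
    then obtain z2 where z2: "z2 \<in> tail_hull_core x I"
      using tail_hull_core_nonempty bdd by blast
    then have "z2 = z1" using unique tail_hull_core_subset by blast
    have "inner z1 v + e \<le> inner z2 v"
      by (rule tail_hull_core_inner_ge[OF z2 tendsto_const]) (simp add: I_def)
    with \<open>z2 = z1\<close> e show False by simp
  qed
  have "(\<lambda>n. inner (x n) v) \<longlonglongrightarrow> inner z1 v" for v
  proof (rule order_tendstoI)
    fix a assume "a < inner z1 v"
    then show "\<forall>\<^sub>F n in sequentially. a < inner (x n) v"
      using upper[of "inner z1 v - a" "- v"] by simp
  next
    fix a assume "inner z1 v < a"
    then show "\<forall>\<^sub>F n in sequentially. inner (x n) v < a"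
      using upper[of "a - inner z1 v" v] by simp
  qed
  then show ?thesis using z1 core by (auto simp: weakly_converges_to_def)
qed


section \<open>The Lyapunov inequality for one relaxed inertial step\<close>

text \<open>The estimate of one step before the correction \<open>u\<close> is bounded.  Cocoercivity, used at \<open>y\<close> although
  monotonicity of \<open>A\<close> is used at \<open>p\<close>, costs \<open>\<gamma> / (2 * \<mu>) * energy (y - p)\<close>.  Relaxation contributes
  through \<open>lam * (p - z) = lam * (x' - z) - lam * (1 - lam) * (y - p)\<close>, which brings the pairing with
  the corrections to the new iterate \<open>x'\<close>, where it telescopes.\<close>

lemma relaxed_step:
  fixes y p z u u' c cz x' :: 'a
  assumes mono: "0 \<le> inner (p - z) (S (y - p) - u' + u - \<gamma> *\<^sub>R (c - cz))"
    and coco: "\<mu> * dual_energy (c - cz) \<le> inner (y - z) (c - cz)"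
    and "\<mu> > 0" "\<gamma> \<ge> 0" "lam \<ge> 0"
    and x': "x' = (1 - lam) *\<^sub>R y + lam *\<^sub>R p"
  shows "energy (x' - z) + 2 * lam * inner (x' - z) u'
    \<le> energy (y - z) + 2 * lam * inner (x' - z) u + 2 * lam * (1 - lam) * inner (y - p) (u' - u)
      - lam * (2 - lam - \<gamma> / (2 * \<mu>)) * energy (y - p)"
proof -
  define Y where "Y = y - z"
  define P where "P = p - z"
  define w where "w = c - cz"
  have yp: "y - p = Y - P" by (simp add: Y_def P_def)
  have x'z: "x' - z = (1 - lam) *\<^sub>R Y + lam *\<^sub>R P"
    by (simp add: x' Y_def P_def algebra_simps)
  have "2 * inner (Y - P) w \<le> energy (Y - P) / (2 * \<mu>) + 2 * \<mu> * dual_energy w"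
    using young[of "1 / (2 * \<mu>)" "Y - P" w] \<open>\<mu> > 0\<close> by (simp add: mult.commute)
  moreover have "inner P w = inner Y w - inner (Y - P) w"
    by (simp add: inner_diff_left)
  ultimately have Pw: "- (2 * inner P w) \<le> energy (Y - P) / (2 * \<mu>)"
    using coco unfolding Y_def[symmetric] w_def[symmetric] by linarith
  then have "- (2 * (\<gamma> * inner P w)) \<le> \<gamma> * (energy (Y - P) / (2 * \<mu>))"
    using mult_left_mono[OF Pw \<open>\<gamma> \<ge> 0\<close>] by (simp add: mult.left_commute)
  moreover have "0 \<le> inner P (S (Y - P)) - inner P u' + inner P u - \<gamma> * inner P w"
    using mono unfolding yp P_def[symmetric] w_def[symmetric]
      inner_add_right inner_diff_right inner_scaleR_right .
  moreover have "2 * inner P (S (Y - P)) = energy Y - energy P - energy (Y - P)"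
    using inner_S_commute[of Y P] by (simp add: energy_diff S.diff inner_diff_right inner_commute)
  moreover have "\<gamma> * (energy (Y - P) / (2 * \<mu>)) = \<gamma> / (2 * \<mu>) * energy (Y - P)" by simp
  ultimately have key: "0 \<le> energy Y - energy P - energy (Y - P) - 2 * inner P u' + 2 * inner P u
      + \<gamma> / (2 * \<mu>) * energy (Y - P)"
    by linarith
  define g where "g = \<gamma> / (2 * \<mu>)"
  have ex: "energy (x' - z) = (1 - lam) * energy Y + lam * energy P - lam * (1 - lam) * energy (Y - P)"
    unfolding x'z energy_add energy_scaleR energy_diff S.scaleR inner_scaleR_left inner_scaleR_right
    by algebra
  have "energy (y - z) + 2 * lam * inner (x' - z) u + 2 * lam * (1 - lam) * inner (y - p) (u' - u)
      - lam * (2 - lam - g) * energy (y - p) - (energy (x' - z) + 2 * lam * inner (x' - z) u')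
    = lam * (energy Y - energy P - energy (Y - P) - 2 * inner P u' + 2 * inner P u + g * energy (Y - P))"
    unfolding ex yp unfolding x'z Y_def[symmetric] inner_add_left inner_diff_left inner_scaleR_left
      inner_diff_right
    by algebra
  also have "\<dots> \<ge> 0" using key \<open>lam \<ge> 0\<close> by (simp add: g_def)
  finally show ?thesis by (simp add: g_def)
qed

lemma inertial_expansion:
  "energy (x + \<alpha> *\<^sub>R (x - xprev) - z)
    = energy (x - z) + \<alpha> * (energy (x - z) - energy (xprev - z)) + \<alpha> * (1 + \<alpha>) * energy (x - xprev)"
proof -
  define X where "X = x - z"
  define d where "d = x - xprev"
  have "x + \<alpha> *\<^sub>R (x - xprev) - z = X + \<alpha> *\<^sub>R d" "xprev - z = X - d" by (simp_all add: X_def d_def)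
  moreover have "energy (X + \<alpha> *\<^sub>R d)
      = energy X + \<alpha> * (energy X - energy (X - d)) + \<alpha> * (1 + \<alpha>) * energy d"
    unfolding energy_add energy_diff S.scaleR inner_scaleR_left inner_scaleR_right by algebra
  ultimately show ?thesis by (simp only: X_def[symmetric] d_def[symmetric])
qed

text \<open>The difference of the two sides is \<open>\<alpha> * energy ((x' - x) - (x - xprev))\<close>.\<close>

lemma inertial_increment:
  assumes "0 \<le> \<alpha>"
  shows "(1 - \<alpha>) * energy (x' - x) - \<alpha> * (1 - \<alpha>) * energy (x - xprev)
    \<le> energy (x' - (x + \<alpha> *\<^sub>R (x - xprev)))"
proof -
  define D where "D = x' - x"
  define d where "d = x - xprev"
  have "0 \<le> \<alpha> * energy (D - d)" using assms by simp
  also have "\<alpha> * energy (D - d)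
      = energy (D - \<alpha> *\<^sub>R d) - ((1 - \<alpha>) * energy D - \<alpha> * (1 - \<alpha>) * energy d)"
    unfolding energy_diff S.scaleR inner_scaleR_left inner_scaleR_right by algebra
  also have "D - \<alpha> *\<^sub>R d = x' - (x + \<alpha> *\<^sub>R (x - xprev))" by (simp add: D_def d_def)
  finally show ?thesis by (simp add: D_def d_def)
qed

text \<open>The pairings of \<open>relaxed_step\<close> that do not telescope are bounded by Young's inequality:
  \<open>2 * lam * \<langle>x' - x | u\<rangle>\<close> produces the term \<open>lam * \<zeta>0\<close> of \<open>\<eta>\<close> and a multiple of \<open>q0\<close>, and
  \<open>2 * lam * (1 - lam) * \<langle>y - p | u' - u\<rangle>\<close> produces \<open>\<bar>1 - lam\<bar> * \<nu>\<close> and another multiple of \<open>q0\<close>.  The two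
  alternatives for \<open>\<nu>\<close> arise because the part with \<open>u'\<close> has a favourable sign if \<open>lam \<ge> 1\<close> and
  \<open>u' = T p - T y\<close> with \<open>- T\<close> monotone.  The multiples of \<open>q0\<close> add up to the last term of the Lyapunov function.\<close>

lemma lyapunov_step:
  fixes x xprev y p z u u' c cz x' :: 'a
  assumes mono: "0 \<le> inner (p - z) (S (y - p) - u' + u - \<gamma> *\<^sub>R (c - cz))"
    and coco: "\<mu> * dual_energy (c - cz) \<le> inner (y - z) (c - cz)"
    and pos: "\<mu> > 0" "\<gamma> \<ge> 0" "lam > 0" "0 \<le> \<alpha>"
    and y: "y = x + \<alpha> *\<^sub>R (x - xprev)"
    and x': "x' = (1 - lam) *\<^sub>R y + lam *\<^sub>R p"
    and u: "0 \<le> \<zeta>0" "0 \<le> q0" "dual_energy u \<le> \<zeta>0\<^sup>2 * q0"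
    and u': "0 \<le> \<zeta>" "dual_energy u' \<le> \<zeta>\<^sup>2 * energy (y - p)"
    and \<nu>: "\<nu> = 2 * \<zeta> + \<zeta>0 \<or> \<nu> = \<zeta>0 \<and> lam \<ge> 1 \<and> 0 \<le> inner (y - p) u'"
    and \<rho>: "\<rho> = 2 - lam - \<bar>1 - lam\<bar> * \<nu> - \<gamma> / (2 * \<mu>) - (1 + \<bar>1 - lam\<bar>) * \<zeta>" "\<rho> \<ge> 0"
  shows "energy (x' - z) + 2 * lam * inner (x' - z) u' + lam * (1 + \<bar>1 - lam\<bar>) * \<zeta> * energy (y - p)
    \<le> energy (x - z) + 2 * lam * inner (x - z) u + lam * (1 + \<bar>1 - lam\<bar>) * \<zeta>0 * q0
      + \<alpha> * (energy (x - z) - energy (xprev - z))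
      + (\<alpha> * (1 + \<alpha>) + \<alpha> * (1 - \<alpha>) * (\<rho> / lam)) * energy (x - xprev)
      - ((1 - \<alpha>) * (\<rho> / lam) - lam * \<zeta>0) * energy (x' - x)"
proof -
  define q where "q = energy (y - p)"
  define a where "a = \<bar>1 - lam\<bar>"
  define G where "G = \<gamma> / (2 * \<mu>)"
  define r where "r = \<rho> / lam"
  have r: "\<rho> = r * lam" "0 \<le> r" using pos \<rho>(2) by (simp_all add: r_def)
  have q: "0 \<le> q" and a: "0 \<le> a" by (simp_all add: q_def a_def)
  have "2 * ((1 - lam) * inner (y - p) u') \<le> a * ((\<nu> - \<zeta>0) * q)"
  proof (cases "\<nu> = 2 * \<zeta> + \<zeta>0")
    case True
    have "2 * ((1 - lam) * inner (y - p) u') \<le> a * (2 * \<bar>inner (y - p) u'\<bar>)"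
      using abs_ge_self[of "(1 - lam) * inner (y - p) u'"] by (simp add: a_def abs_mult)
    also have "\<dots> \<le> a * (\<zeta> * (1 * energy (y - p) + q / 1))"
      using u' q a by (intro mult_left_mono young_lipschitz) (auto simp: q_def)
    finally show ?thesis using True by (simp add: q_def)
  next
    case False
    then have "\<nu> = \<zeta>0" "(1 - lam) * inner (y - p) u' \<le> 0"
      using \<nu> by (auto simp: mult_nonpos_nonneg)
    then show ?thesis by simp
  qed
  moreover have "- (2 * ((1 - lam) * inner (y - p) u)) \<le> a * (\<zeta>0 * (q + q0))"
  proof -
    have "- (2 * ((1 - lam) * inner (y - p) u)) \<le> a * (2 * \<bar>inner (y - p) u\<bar>)"
      using abs_ge_minus_self[of "(1 - lam) * inner (y - p) u"] by (simp add: a_def abs_mult)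
    also have "\<dots> \<le> a * (\<zeta>0 * (1 * energy (y - p) + q0 / 1))"
      using u a by (intro mult_left_mono young_lipschitz) auto
    finally show ?thesis by (simp add: q_def)
  qed
  moreover have "2 * ((1 - lam) * inner (y - p) (u' - u))
      = 2 * ((1 - lam) * inner (y - p) u') + - (2 * ((1 - lam) * inner (y - p) u))"
    unfolding inner_diff_right by algebra
  moreover have "a * (\<nu> * q + \<zeta>0 * q0) = a * ((\<nu> - \<zeta>0) * q) + a * (\<zeta>0 * (q + q0))"
    by algebra
  ultimately have "2 * ((1 - lam) * inner (y - p) (u' - u)) \<le> a * (\<nu> * q + \<zeta>0 * q0)"
    by linarith
  then have "lam * (2 * ((1 - lam) * inner (y - p) (u' - u))) \<le> lam * (a * (\<nu> * q + \<zeta>0 * q0))"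
    using pos by (intro mult_left_mono) auto
  moreover have "2 * lam * (1 - lam) * inner (y - p) (u' - u)
      = lam * (2 * ((1 - lam) * inner (y - p) (u' - u)))"
    by algebra
  ultimately
  have cross: "2 * lam * (1 - lam) * inner (y - p) (u' - u) \<le> lam * (a * (\<nu> * q + \<zeta>0 * q0))"
    by simp
  have "2 * \<bar>inner (x' - x) u\<bar> \<le> \<zeta>0 * (1 * energy (x' - x) + q0 / 1)"
    using u by (intro young_lipschitz) auto
  then have "2 * inner (x' - x) u \<le> \<zeta>0 * (energy (x' - x) + q0)" by simp
  from mult_left_mono[OF this, of lam]
  have shift: "2 * lam * inner (x' - z) u \<le> 2 * lam * inner (x - z) u + lam * (\<zeta>0 * (energy (x' - x) + q0))"
    using pos by (simp add: inner_diff_left algebra_simps)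
  have "x' - y = lam *\<^sub>R (p - y)" by (simp add: x' algebra_simps)
  then have "energy (x' - y) = lam\<^sup>2 * energy (p - y)" by (simp only: energy_scaleR)
  also have "energy (p - y) = q"
    using energy_scaleR[of "-1" "y - p"] by (simp add: q_def)
  finally have "(1 - \<alpha>) * energy (x' - x) - \<alpha> * (1 - \<alpha>) * energy (x - xprev) \<le> lam\<^sup>2 * q"
    using inertial_increment[OF pos(4), of x' x xprev] y by simp
  then have "r * ((1 - \<alpha>) * energy (x' - x) - \<alpha> * (1 - \<alpha>) * energy (x - xprev)) \<le> r * (lam\<^sup>2 * q)"
    using r(2) by (rule mult_left_mono)
  moreover have "r * ((1 - \<alpha>) * energy (x' - x) - \<alpha> * (1 - \<alpha>) * energy (x - xprev))
      = (1 - \<alpha>) * r * energy (x' - x) - \<alpha> * (1 - \<alpha>) * r * energy (x - xprev)"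
    by algebra
  moreover have "r * (lam\<^sup>2 * q) = lam * \<rho> * q" unfolding r(1) by algebra
  ultimately
  have incr: "(1 - \<alpha>) * r * energy (x' - x) - \<alpha> * (1 - \<alpha>) * r * energy (x - xprev) \<le> lam * \<rho> * q"
    by simp
  have step: "energy (x' - z) + 2 * lam * inner (x' - z) u' \<le> energy (y - z) + 2 * lam * inner (x' - z) u
      + 2 * lam * (1 - lam) * inner (y - p) (u' - u) - lam * (2 - lam - G) * q"
    using relaxed_step[OF mono coco pos(1,2) _ x'] pos(3) by (simp add: q_def G_def)
  have expand: "energy (y - z) = energy (x - z) + \<alpha> * (energy (x - z) - energy (xprev - z))
      + \<alpha> * (1 + \<alpha>) * energy (x - xprev)"
    unfolding y by (rule inertial_expansion)
  have rest: "lam * (2 - lam - G) * q = lam * \<rho> * q + lam * (a * (\<nu> * q)) + lam * (1 + a) * \<zeta> * q"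
    unfolding \<rho>(1) a_def[symmetric] G_def[symmetric] by algebra
  have young_terms: "lam * (a * (\<nu> * q + \<zeta>0 * q0)) + lam * (\<zeta>0 * (energy (x' - x) + q0))
      = lam * (a * (\<nu> * q)) + lam * (1 + a) * \<zeta>0 * q0 + lam * \<zeta>0 * energy (x' - x)"
    by algebra
  have inertial_terms: "(\<alpha> * (1 + \<alpha>) + \<alpha> * (1 - \<alpha>) * r) * energy (x - xprev)
      - ((1 - \<alpha>) * r - lam * \<zeta>0) * energy (x' - x)
    = \<alpha> * (1 + \<alpha>) * energy (x - xprev) + lam * \<zeta>0 * energy (x' - x)
      - ((1 - \<alpha>) * r * energy (x' - x) - \<alpha> * (1 - \<alpha>) * r * energy (x - xprev))"
    by algebra
  have sum_up: "e' + i' + s' \<le> e + i + s + h + (k - l)"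
    if "e' + i' \<le> ey + j + c - b" "ey = e + h + g" "c \<le> c'" "j \<le> i + m" "n \<le> f"
      "b = f + t + s'" "c' + m = t + s + v" "k - l = g + v - n"
    for e' i' s' e i s h k l ey j c b g c' m n f t v :: real
    using that by linarith
  have "energy (x' - z) + 2 * lam * inner (x' - z) u' + lam * (1 + a) * \<zeta> * q
    \<le> energy (x - z) + 2 * lam * inner (x - z) u + lam * (1 + a) * \<zeta>0 * q0
      + \<alpha> * (energy (x - z) - energy (xprev - z))
      + ((\<alpha> * (1 + \<alpha>) + \<alpha> * (1 - \<alpha>) * r) * energy (x - xprev)
      - ((1 - \<alpha>) * r - lam * \<zeta>0) * energy (x' - x))"
    by (rule sum_up[OF step expand cross shift incr rest young_terms inertial_terms])
  then show ?thesis by (simp only: q_def a_def r_def add_diff_eq)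
qed

text \<open>Young's inequality with weight \<open>1 / (1 + \<bar>1 - lam\<bar>)\<close> uses up exactly the last term.\<close>

lemma lyapunov_lower_bound:
  assumes u: "0 \<le> \<zeta>" "0 \<le> q" "dual_energy u \<le> \<zeta>\<^sup>2 * q" and lam: "0 < lam"
  shows "(1 - lam * \<zeta> / (1 + \<bar>1 - lam\<bar>)) * energy v
    \<le> energy v + 2 * lam * inner v u + lam * (1 + \<bar>1 - lam\<bar>) * \<zeta> * q"
proof -
  define b where "b = 1 + \<bar>1 - lam\<bar>"
  have b: "b > 0" by (simp add: b_def add_pos_nonneg)
  have "2 * \<bar>inner v u\<bar> \<le> \<zeta> * ((1 / b) * energy v + q / (1 / b))"
    using u b by (intro young_lipschitz) auto
  then have "- (2 * inner v u) \<le> \<zeta> * ((1 / b) * energy v + q * b)" by simp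
  from mult_left_mono[OF this, of lam]
  have "- (2 * lam * inner v u) \<le> lam * \<zeta> / b * energy v + lam * b * \<zeta> * q"
    using lam by (simp add: algebra_simps)
  then show ?thesis unfolding b_def[symmetric] by (simp add: left_diff_distrib)
qed

end


section \<open>Real sequences with inertial decrease\<close>

text \<open>A discrete Alvarez-Attouch argument.  The sequence \<open>\<Theta>\<close> in the last conclusion decreases.  Together
  with the margin \<open>\<kappa>\<close> this gives \<open>(\<alpha> k + \<kappa>) * \<phi> (k + 1) \<le> \<Theta> 0 + \<alpha> k * \<phi> k\<close>, a recursion that keeps \<open>\<phi>\<close>
  bounded even if \<open>\<alpha>\<close> approaches \<open>1\<close>; then \<open>\<Theta>\<close> is bounded below, and its decrements control \<open>d\<close>.\<close>

lemma inertial_lyapunov_decrease: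
  fixes L \<phi> d \<alpha> \<xi> \<eta> :: "nat \<Rightarrow> real"
  assumes step: "\<And>k. L (Suc k) \<le> L k + \<alpha> k * (\<phi> (Suc k) - \<phi> k) + \<xi> k * d k - \<eta> k * d (Suc k)"
    and lower: "\<And>k. (\<alpha> k + \<kappa>) * \<phi> (Suc k) \<le> L k" "\<kappa> > 0"
    and gap: "\<And>k. \<delta> \<le> \<eta> k - \<xi> (Suc k)" "\<delta> > 0"
    and nonneg: "\<And>k. 0 \<le> \<phi> k" "\<And>k. 0 \<le> d k" "\<And>k. 0 \<le> \<xi> k"
    and \<alpha>: "\<And>k. 0 \<le> \<alpha> k" "\<And>k. \<alpha> k \<le> 1" "\<And>k. \<alpha> k \<le> \<alpha> (Suc k)"
  shows "Bseq \<phi>" "d \<longlonglongrightarrow> 0" "convergent (\<lambda>k. L k - \<alpha> k * \<phi> k + \<xi> k * d k)"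
proof -
  define \<Theta> where "\<Theta> k = L k - \<alpha> k * \<phi> k + \<xi> k * d k" for k
  have dec: "\<Theta> (Suc k) \<le> \<Theta> k - \<delta> * d (Suc k)" for k
  proof -
    have "0 \<le> (\<alpha> (Suc k) - \<alpha> k) * \<phi> (Suc k)" "\<delta> * d (Suc k) \<le> (\<eta> k - \<xi> (Suc k)) * d (Suc k)"
      using nonneg \<alpha> gap by (auto intro: mult_right_mono)
    then show ?thesis using step[of k] by (simp add: \<Theta>_def algebra_simps)
  qed
  have dec': "\<Theta> (Suc k) \<le> \<Theta> k" for k
  proof -
    have "0 \<le> \<delta> * d (Suc k)" using gap nonneg by simp
    then show ?thesis using dec[of k] by linarith
  qed
  then have "decseq \<Theta>" by (rule decseq_SucI)
  \<comment> \<open>Any bound \<open>B\<close> with \<open>\<Theta> 0 \<le> \<kappa> * B\<close> is preserved by the recursion for \<open>\<phi>\<close>.\<close>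
  define B where "B = max (\<phi> 0) (\<bar>\<Theta> 0\<bar> / \<kappa>)"
  have B: "0 \<le> B" "\<Theta> 0 \<le> \<kappa> * B"
  proof -
    show "0 \<le> B" using nonneg(1)[of 0] by (simp add: B_def)
    have "\<bar>\<Theta> 0\<bar> / \<kappa> \<le> B" by (simp add: B_def)
    then show "\<Theta> 0 \<le> \<kappa> * B" using lower(2) by (simp add: field_simps)
  qed
  have bound: "\<phi> k \<le> B" for k
  proof (induction k)
    case 0
    show ?case by (simp add: B_def)
  next
    case (Suc k)
    have "\<Theta> k \<le> \<Theta> 0" using \<open>decseq \<Theta>\<close> by (simp add: decseq_def)
    moreover have "0 \<le> \<xi> k * d k" using nonneg by simp
    moreover have "\<alpha> k * \<phi> k \<le> \<alpha> k * B" using Suc \<alpha> by (intro mult_left_mono) auto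
    ultimately have "(\<alpha> k + \<kappa>) * \<phi> (Suc k) \<le> (\<alpha> k + \<kappa>) * B"
      using lower(1)[of k] B(2) by (simp add: \<Theta>_def distrib_right)
    moreover have "0 < \<alpha> k + \<kappa>" using \<alpha>(1)[of k] lower(2) by simp
    ultimately show ?case by simp
  qed
  show "Bseq \<phi>" using bound nonneg(1) by (intro BseqI'[of _ B]) simp
  have "- B \<le> \<Theta> k" for k
  proof -
    have "0 \<le> (\<alpha> k + \<kappa>) * \<phi> (Suc k)" using nonneg \<alpha>(1)[of k] lower(2) by simp
    moreover have "\<alpha> k * \<phi> k \<le> 1 * B" using \<alpha> bound nonneg by (intro mult_mono) auto
    moreover have "0 \<le> \<xi> k * d k" using nonneg by simp
    ultimately show ?thesis using lower(1)[of k] by (simp add: \<Theta>_def)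
  qed
  then obtain l where l: "\<Theta> \<longlonglongrightarrow> l" using decseq_convergent[OF \<open>decseq \<Theta>\<close>] by blast
  then show "convergent (\<lambda>k. L k - \<alpha> k * \<phi> k + \<xi> k * d k)"
    unfolding \<Theta>_def by (auto simp: convergent_def)
  have "(\<lambda>k. (\<Theta> k - \<Theta> (Suc k)) / \<delta>) \<longlonglongrightarrow> (l - l) / \<delta>"
    using l LIMSEQ_Suc[OF l] gap(2) by (intro tendsto_intros) auto
  moreover have "norm (d (Suc k)) \<le> (\<Theta> k - \<Theta> (Suc k)) / \<delta>" for k
    using dec[of k] nonneg(2)[of "Suc k"] gap(2) by (simp add: pos_le_divide_eq mult.commute)
  ultimately have "(\<lambda>k. d (Suc k)) \<longlonglongrightarrow> 0"
    by (intro Lim_null_comparison[of "\<lambda>k. d (Suc k)" "\<lambda>k. (\<Theta> k - \<Theta> (Suc k)) / \<delta>"]) auto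
  then show "d \<longlonglongrightarrow> 0" by (rule LIMSEQ_imp_Suc)
qed

text \<open>Up to terms that vanish in the limit, the convergent sequence in the first assumption is
  \<open>(1 - \<alpha> k) * \<phi> k\<close>, and \<open>1 - \<alpha> k\<close> has a nonzero limit.\<close>

lemma inertial_sequence_convergent:
  fixes L \<phi> d \<alpha> \<xi> :: "nat \<Rightarrow> real"
  assumes \<Theta>: "convergent (\<lambda>k. L k - \<alpha> k * \<phi> k + \<xi> k * d k)"
    and L: "(\<lambda>k. L k - \<phi> (Suc k)) \<longlonglongrightarrow> 0" and \<phi>: "(\<lambda>k. \<phi> (Suc k) - \<phi> k) \<longlonglongrightarrow> 0"
    and \<xi>: "\<And>k. \<bar>\<xi> k\<bar> \<le> K" and d: "d \<longlonglongrightarrow> 0"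
    and \<alpha>: "\<And>k. \<alpha> k \<le> \<alpha> (Suc k)" "\<And>k. \<alpha> k \<le> 1 - c" "c > 0"
  shows "convergent \<phi>"
proof -
  obtain l where l: "(\<lambda>k. L k - \<alpha> k * \<phi> k + \<xi> k * d k) \<longlonglongrightarrow> l"
    using \<Theta> by (auto simp: convergent_def)
  have "incseq \<alpha>" using \<alpha>(1) by (rule incseq_SucI)
  then obtain a where a: "\<alpha> \<longlonglongrightarrow> a" using incseq_convergent \<alpha>(2) by blast
  have "a \<le> 1 - c" using \<alpha>(2) by (intro LIMSEQ_le_const2[OF a]) auto
  then have ne: "1 - a \<noteq> 0" using \<alpha>(3) by simp
  have "(\<lambda>k. \<xi> k * d k) \<longlonglongrightarrow> 0" using bounded_scaleR_tendsto_zero[of \<xi>, OF \<xi> d] by simp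
  then have "(\<lambda>k. ((L k - \<alpha> k * \<phi> k + \<xi> k * d k) - (L k - \<phi> (Suc k)) - (\<phi> (Suc k) - \<phi> k) - \<xi> k * d k)
      / (1 - \<alpha> k)) \<longlonglongrightarrow> (l - 0 - 0 - 0) / (1 - a)"
    using l L \<phi> a ne by (intro tendsto_intros) auto
  moreover have "((L k - \<alpha> k * \<phi> k + \<xi> k * d k) - (L k - \<phi> (Suc k)) - (\<phi> (Suc k) - \<phi> k) - \<xi> k * d k)
      / (1 - \<alpha> k) = \<phi> k" for k
  proof -
    have "1 - \<alpha> k \<noteq> 0" using \<alpha>(2)[of k] \<alpha>(3) by simp
    then show ?thesis by (simp add: field_simps)
  qed
  ultimately show ?thesis by (auto simp: convergent_def)
qed

text \<open>For \<open>lam \<ge> 1\<close> the right-hand side of the conclusion is \<open>1 - \<zeta>0\<close>.  As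
  \<open>(1 - \<alpha>) * (\<rho> / lam) \<le> 1\<close>, the gap condition gives \<open>1 \<ge> \<delta> + lam * \<zeta>0 + \<xi>' \<ge> \<delta> + \<zeta>0 + \<alpha>\<close>.\<close>

lemma inertial_margin_overrelaxed:
  fixes lam \<alpha> \<alpha>' \<rho> \<zeta>0 \<xi>' \<delta> :: real
  assumes "1 \<le> lam" "0 \<le> \<alpha>" "\<alpha> \<le> 1" "0 \<le> \<rho>" "\<rho> \<le> 2 - lam" "0 \<le> \<zeta>0"
    and "\<alpha> \<le> \<alpha>'" "\<alpha>' * (1 + \<alpha>') \<le> \<xi>'"
    and gap: "\<delta> \<le> (1 - \<alpha>) * (\<rho> / lam) - lam * \<zeta>0 - \<xi>'"
  shows "\<alpha> + \<delta> \<le> 1 - lam * \<zeta>0 / (1 + \<bar>1 - lam\<bar>)"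
proof -
  have "\<rho> / lam \<le> 1" using assms by simp
  then have "(1 - \<alpha>) * (\<rho> / lam) \<le> 1 * 1" using assms by (intro mult_mono) auto
  moreover have "1 * \<zeta>0 \<le> lam * \<zeta>0" using assms by (intro mult_right_mono) auto
  moreover have "\<alpha> \<le> \<xi>'" using assms by (smt (verit) mult_left_mono mult_cancel_left2)
  moreover have "lam * \<zeta>0 / (1 + \<bar>1 - lam\<bar>) = \<zeta>0" using assms(1) by simp
  ultimately show ?thesis using gap by linarith
qed

text \<open>For \<open>lam < 1\<close> the quotient \<open>\<rho> / lam\<close> can be large, and the gap condition is only useful with the
  same index in both terms, in the form \<open>\<delta> + lam * \<zeta>0 \<le> (1 - \<alpha>)\<^sup>2 * (2 - lam) / lam\<close>.  With
  \<open>b = lam * \<zeta>0 / (2 - lam)\<close>, which is at most \<open>lam\<close>, this bounds the difference of squares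
  \<open>(1 - \<alpha>)\<^sup>2 - b\<^sup>2\<close> from below, and hence \<open>1 - \<alpha> - b\<close>, as \<open>1 - \<alpha> + b \<le> 2\<close>.\<close>

lemma inertial_margin_underrelaxed:
  fixes lam \<alpha> \<rho> \<zeta>0 \<delta> :: real
  assumes lam: "0 < lam" "lam < 1" and \<alpha>: "0 \<le> \<alpha>" "\<alpha> \<le> 1" and \<rho>: "\<rho> \<le> 2 - lam"
    and \<zeta>0: "0 \<le> \<zeta>0" "\<zeta>0 \<le> 1" and \<delta>: "\<delta> > 0"
    and gap: "\<delta> \<le> (1 - \<alpha>) * (\<rho> / lam) - lam * \<zeta>0 - (\<alpha> * (1 + \<alpha>) + \<alpha> * (1 - \<alpha>) * (\<rho> / lam))"
  shows "\<alpha> + lam * \<delta> / (2 * (2 - lam)) \<le> 1 - lam * \<zeta>0 / (1 + \<bar>1 - lam\<bar>)"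
proof -
  define D where "D = 2 - lam"
  define b where "b = lam * \<zeta>0 / D"
  define \<kappa> where "\<kappa> = lam * \<delta> / (2 * D)"
  have D: "D > 1" using lam by (simp add: D_def)
  have \<kappa>: "\<kappa> > 0" using lam \<delta> D by (simp add: \<kappa>_def)
  have "lam * \<zeta>0 \<le> lam * D" using lam \<zeta>0 D by (intro mult_left_mono) auto
  then have b: "0 \<le> b" "b \<le> lam" using lam \<zeta>0 D by (simp_all add: b_def pos_divide_le_eq)
  have "0 \<le> \<alpha> * (1 + \<alpha>)" using \<alpha> by simp
  moreover have "(1 - \<alpha>) * (\<rho> / lam) - \<alpha> * (1 - \<alpha>) * (\<rho> / lam) = (1 - \<alpha>)\<^sup>2 * (\<rho> / lam)"
    by algebra
  moreover have "(1 - \<alpha>)\<^sup>2 * (\<rho> / lam) \<le> (1 - \<alpha>)\<^sup>2 * (D / lam)"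
    using \<rho> lam by (intro mult_left_mono divide_right_mono) (auto simp: D_def)
  ultimately have "\<delta> + lam * \<zeta>0 \<le> (1 - \<alpha>)\<^sup>2 * (D / lam)" using gap by linarith
  then have "(\<delta> + lam * \<zeta>0) * (lam / D) \<le> (1 - \<alpha>)\<^sup>2 * (D / lam) * (lam / D)"
    using lam D by (intro mult_right_mono) auto
  moreover have "(\<delta> + lam * \<zeta>0) * (lam / D) = 2 * \<kappa> + lam * b"
    using D by (simp add: \<kappa>_def b_def field_simps)
  moreover have "(1 - \<alpha>)\<^sup>2 * (D / lam) * (lam / D) = (1 - \<alpha>)\<^sup>2" using lam D by simp
  ultimately have "2 * \<kappa> + lam * b \<le> (1 - \<alpha>)\<^sup>2" by linarith
  moreover have "b * b \<le> lam * b" using b by (intro mult_right_mono) auto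
  ultimately have prod: "2 * \<kappa> \<le> (1 - \<alpha> - b) * (1 - \<alpha> + b)"
    by (simp add: power2_eq_square algebra_simps)
  have s: "0 \<le> 1 - \<alpha> + b" "1 - \<alpha> + b \<le> 2" using \<alpha> b lam by auto
  have "\<kappa> \<le> 1 - \<alpha> - b"
  proof (rule ccontr)
    assume "\<not> ?thesis"
    then have t: "1 - \<alpha> - b < \<kappa>" by simp
    have "1 - \<alpha> + b \<noteq> 0"
    proof
      assume "1 - \<alpha> + b = 0"
      with prod have "2 * \<kappa> \<le> 0" by (simp only: mult_zero_right)
      with \<kappa> show False by simp
    qed
    with s(1) have "0 < 1 - \<alpha> + b" by linarith
    with t have "(1 - \<alpha> - b) * (1 - \<alpha> + b) < \<kappa> * (1 - \<alpha> + b)" by (rule mult_strict_right_mono)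
    also have "\<dots> \<le> \<kappa> * 2" using s \<kappa> by (intro mult_left_mono) auto
    finally show False using prod by linarith
  qed
  then show ?thesis using lam by (simp add: \<kappa>_def b_def D_def)
qed


section \<open>Weak convergence of the relaxed inertial iteration\<close>

theorem theorem4p4:
  fixes A :: "'a::{real_inner, complete_space} \<Rightarrow> 'a set"
    and C S :: "'a \<Rightarrow> 'a"
    and M T :: "nat \<Rightarrow> 'a \<Rightarrow> 'a"
    and \<mu> \<gamma>_low \<gamma>_up eps lam \<delta> :: real
    and \<gamma> \<zeta> \<alpha> \<nu> \<rho> \<eta> \<xi> :: "nat \<Rightarrow> real"
    and xm1 :: 'a
    and x y p u :: "nat \<Rightarrow> 'a"
    and N0 :: nat
  assumes S: "bounded_linear S" "self_adjoint S" "strongly_monotone_linear S"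
    and A: "maximally_monotone_op A"
    and C: "\<mu> > 0" "cocoercive_wrt S \<mu> C"
    and Z_nonempty: "zer (sum_op A (single C)) \<noteq> {}"
    and \<gamma>: "\<gamma>_low > 0" "\<gamma>_up > 0" "\<And>n. \<gamma> n \<in> {\<gamma>_low..\<gamma>_up}"
    and eps: "eps \<in> {0<..<1}"
    and \<zeta>: "\<And>n. \<zeta> n \<in> {0..1 - eps}"
    and M: "\<And>n. lipschitz_wrt S (\<zeta> n) (\<lambda>z. \<gamma> n *\<^sub>R M n z - S z)"
    and \<alpha>: "\<And>n. \<alpha> n \<in> {0..1}"
    and lam: "lam \<in> {0<..<2}"
    and iter: "inertial_iteration A C S M \<gamma> \<alpha> lam xm1 x y p u"
    and T_def: "\<And>n. n \<ge> 1 \<Longrightarrow> T n = (\<lambda>z. \<gamma> n *\<^sub>R M n z - S z)"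
    and \<nu>_def: "\<And>n. n \<ge> 1 \<Longrightarrow>
      \<nu> n = (if monotone_single_valued (\<lambda>z. - T n z) \<and> lam \<ge> 1 then \<zeta> (n - 1)
             else 2 * \<zeta> n + \<zeta> (n - 1))"
    and \<rho>_def: "\<And>n. n \<ge> 1 \<Longrightarrow>
      \<rho> n = 2 - lam - \<bar>1 - lam\<bar> * \<nu> n - \<gamma> n / (2 * \<mu>) - (1 + \<bar>1 - lam\<bar>) * \<zeta> n"
    and \<eta>_def: "\<And>n. n \<ge> 1 \<Longrightarrow> \<eta> n = (1 - \<alpha> n) * (\<rho> n / lam) - lam * \<zeta> (n - 1)"
    and \<xi>_def: "\<And>n. n \<ge> 1 \<Longrightarrow>
      \<xi> n = \<alpha> n * (1 + \<alpha> n) + \<alpha> n * (1 - \<alpha> n) * (\<rho> n / lam)"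
    and N0: "N0 \<ge> 1" "mono_on {N0..} \<alpha>"
    and \<delta>: "\<delta> > 0"
    and bounds: "\<And>n. n \<ge> N0 \<Longrightarrow> \<rho> n \<ge> 0 \<and> \<eta> n - \<xi> (n + 1) \<ge> \<delta>"
    and lam_cases: "lam \<in> {1..<2} \<or> (lam \<in> {0<..<1} \<and> mono_on {N0..} \<xi>)"
  shows "\<exists>z \<in> zer (sum_op A (single C)). weakly_converges_to x z"
proof -
  interpret strongly_positive_operator S by (rule strongly_positive_operator.intro) (fact S)+
  define q where "q n = energy (y n - p (Suc n))" for n
  \<comment> \<open>the element of \<open>A (p (n + 1))\<close> that the inclusion singles out\<close>
  define a where "a n = M n (y n) - M n (p (Suc n)) - C (y n) + (1 / \<gamma> n) *\<^sub>R u n" for n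
  let ?Z = "zer (sum_op A (single C))"

  have lam': "0 < lam" "lam < 2" using lam by auto
  have \<gamma>pos: "\<gamma> n > 0" for n using \<gamma>(1) \<gamma>(3)[of n] by auto
  have \<zeta>': "0 \<le> \<zeta> n" "\<zeta> n \<le> 1" for n using \<zeta>[of n] eps by auto
  have \<alpha>': "0 \<le> \<alpha> n" "\<alpha> n \<le> 1" for n using \<alpha>[of n] by auto
  have q: "0 \<le> q n" for n by (simp add: q_def)
  have iteration: "y n = x n + \<alpha> n *\<^sub>R (x n - previous xm1 x n)"
      "p (Suc n) \<in> inverse_op (sum_op (single (M n)) A) (M n (y n) - C (y n) + (1 / \<gamma> n) *\<^sub>R u n)"
      "u (Suc n) = (\<gamma> n *\<^sub>R M n (p (Suc n)) - S (p (Suc n))) - (\<gamma> n *\<^sub>R M n (y n) - S (y n))"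
      "x (Suc n) = (1 - lam) *\<^sub>R y n + lam *\<^sub>R p (Suc n)" for n
    using iter unfolding inertial_iteration_def Suc_eq_plus1 by blast+
  have y_Suc: "y (Suc n) = x (Suc n) + \<alpha> (Suc n) *\<^sub>R (x (Suc n) - x n)" for n
    using iteration(1)[of "Suc n"] by (simp add: previous_def)
  have u_Suc: "u (Suc n) = (\<gamma> n *\<^sub>R M n (p (Suc n)) - S (p (Suc n))) - (\<gamma> n *\<^sub>R M n (y n) - S (y n))"
    and x_Suc: "x (Suc n) = (1 - lam) *\<^sub>R y n + lam *\<^sub>R p (Suc n)" for n
    by (fact iteration)+
  have a_mem: "a n \<in> A (p (Suc n))" for n
  proof -
    from iteration(2)[of n] obtain b where b: "b \<in> A (p (Suc n))"
      "M n (y n) - C (y n) + (1 / \<gamma> n) *\<^sub>R u n = M n (p (Suc n)) + b"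
      unfolding inverse_op_def sum_op_def single_def by blast
    have "b = M n (p (Suc n)) + b - M n (p (Suc n))" by simp
    also have "\<dots> = a n" unfolding b(2)[symmetric] by (simp add: a_def)
    finally show ?thesis using b(1) by simp
  qed
  \<comment> \<open>In this form the kernels have been eliminated in favour of \<open>S\<close> and the corrections.\<close>
  have a_eq: "\<gamma> n *\<^sub>R a n = S (y n - p (Suc n)) - u (Suc n) + u n - \<gamma> n *\<^sub>R C (y n)" for n
    using \<gamma>pos[of n] by (simp add: a_def u_Suc S.diff scaleR_add_right scaleR_diff_right)
  have coco: "\<mu> * dual_energy (C v - C w) \<le> inner (v - w) (C v - C w)" for v w
    using C(2) by (simp add: cocoercive_wrt_def norm_wrt_inv_S_squared)
  have dual_u: "dual_energy (u (Suc n)) \<le> (\<zeta> n)\<^sup>2 * q n" for n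
  proof -
    have "norm_wrt (inv S) (u (Suc n)) \<le> \<zeta> n * norm_wrt S (p (Suc n) - y n)"
      using M[of n] unfolding lipschitz_wrt_def u_Suc by blast
    then have "(norm_wrt (inv S) (u (Suc n)))\<^sup>2 \<le> (\<zeta> n * norm_wrt S (p (Suc n) - y n))\<^sup>2"
      by (rule power_mono) (simp add: norm_wrt_def)
    also have "\<dots> = (\<zeta> n)\<^sup>2 * q n"
      using energy_scaleR[of "-1" "y n - p (Suc n)"]
      by (simp add: power_mult_distrib norm_wrt_S_squared q_def)
    finally show ?thesis by (simp only: norm_wrt_inv_S_squared)
  qed

  have \<nu>_cases: "\<nu> n = 2 * \<zeta> n + \<zeta> (n - 1) \<or>
      \<nu> n = \<zeta> (n - 1) \<and> lam \<ge> 1 \<and> 0 \<le> inner (y n - p (Suc n)) (u (Suc n))" if "n \<ge> 1" for n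
  proof (cases "monotone_single_valued (\<lambda>z. - T n z) \<and> lam \<ge> 1")
    case True
    then have "0 \<le> inner (y n - p (Suc n)) (- T n (y n) - - T n (p (Suc n)))"
      unfolding monotone_single_valued_def by blast
    also have "- T n (y n) - - T n (p (Suc n)) = u (Suc n)"
      unfolding T_def[OF that] u_Suc by simp
    finally show ?thesis using True \<nu>_def[OF that] unfolding if_P[OF True] by simp
  next
    case False
    show ?thesis using \<nu>_def[OF that] unfolding if_not_P[OF False] by (rule disjI1)
  qed

  have \<rho>_le: "\<rho> n \<le> 2 - lam" if "n \<ge> 1" for n
  proof -
    have "0 \<le> \<nu> n" using \<nu>_cases[OF that] \<zeta>'(1)[of n] \<zeta>'(1)[of "n - 1"] by auto
    then have "0 \<le> \<bar>1 - lam\<bar> * \<nu> n" "0 \<le> (1 + \<bar>1 - lam\<bar>) * \<zeta> n" "0 \<le> \<gamma> n / (2 * \<mu>)"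
      using \<zeta>'(1)[of n] \<gamma>pos[of n] C(1) by simp_all
    then show ?thesis unfolding \<rho>_def[OF that] by linarith
  qed
  have \<rho>_nonneg: "0 \<le> \<rho> n" if "n \<ge> N0" for n using bounds[OF that] by blast
  have \<alpha>_mono: "\<alpha> n \<le> \<alpha> (Suc n)" if "n \<ge> N0" for n
    using N0(2) that by (auto intro: mono_onD)
  have \<xi>_lower: "\<alpha> n * (1 + \<alpha> n) \<le> \<xi> n" if "n \<ge> N0" for n
    using \<xi>_def[of n] \<rho>_nonneg[OF that] \<alpha>'[of n] lam'(1) that N0(1) by simp
  have \<xi>_nonneg: "0 \<le> \<xi> n" if "n \<ge> N0" for n
    using \<xi>_lower[OF that] \<alpha>'[of n] by (meson add_nonneg_nonneg mult_nonneg_nonneg order_trans zero_le_one)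
  have \<rho>_lam: "0 \<le> \<rho> n / lam" "\<rho> n / lam \<le> 2 / lam" if "n \<ge> N0" for n
    using \<rho>_nonneg[OF that] \<rho>_le[of n] lam' that N0(1) by (auto intro: divide_right_mono)
  have \<xi>_upper: "\<xi> n \<le> 2 + 2 / lam" if "n \<ge> N0" for n
  proof -
    have "\<alpha> n * (1 + \<alpha> n) \<le> 1 * 2" using \<alpha>'[of n] by (intro mult_mono) auto
    moreover have "\<alpha> n * (1 - \<alpha> n) \<le> 1 * 1" using \<alpha>'[of n] by (intro mult_mono) auto
    then have "\<alpha> n * (1 - \<alpha> n) * (\<rho> n / lam) \<le> 1 * (2 / lam)"
      using \<rho>_lam[OF that] \<alpha>'[of n] by (intro mult_mono) auto
    ultimately show ?thesis using \<xi>_def[of n] that N0(1) by simp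
  qed
  have gap: "\<delta> \<le> (1 - \<alpha> n) * (\<rho> n / lam) - lam * \<zeta> (n - 1) - \<xi> (Suc n)" if "n \<ge> N0" for n
    using bounds[OF that] \<eta>_def[of n] that N0(1) by simp

  obtain \<kappa> where \<kappa>: "\<kappa> > 0"
    and margin: "\<And>n. n \<ge> N0 \<Longrightarrow> \<alpha> n + \<kappa> \<le> 1 - lam * \<zeta> (n - 1) / (1 + \<bar>1 - lam\<bar>)"
  proof (cases "lam \<ge> 1")
    case True
    have "\<alpha> n + \<delta> \<le> 1 - lam * \<zeta> (n - 1) / (1 + \<bar>1 - lam\<bar>)" if n: "n \<ge> N0" for n
    proof (rule inertial_margin_overrelaxed[OF True \<alpha>' \<rho>_nonneg[OF n] _ \<zeta>'(1) \<alpha>_mono[OF n] _ gap[OF n]])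
      show "\<rho> n \<le> 2 - lam" using \<rho>_le n N0(1) by simp
      show "\<alpha> (Suc n) * (1 + \<alpha> (Suc n)) \<le> \<xi> (Suc n)" using \<xi>_lower n by simp
    qed
    then show ?thesis using that \<delta> by blast
  next
    case False
    have "\<alpha> n + lam * \<delta> / (2 * (2 - lam)) \<le> 1 - lam * \<zeta> (n - 1) / (1 + \<bar>1 - lam\<bar>)"
      if n: "n \<ge> N0" for n
    proof (rule inertial_margin_underrelaxed[OF lam'(1) _ \<alpha>' _ \<zeta>' \<delta>])
      show "lam < 1" using False by simp
      show "\<rho> n \<le> 2 - lam" using \<rho>_le n N0(1) by simp
      \<comment> \<open>The hypothesis compares \<open>\<eta> n\<close> with \<open>\<xi> (n + 1)\<close>; monotonicity of \<open>\<xi>\<close> allows replacing this by \<open>\<xi> n\<close>.\<close>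
      have "mono_on {N0..} \<xi>" using lam_cases False by auto
      then have "\<xi> n \<le> \<xi> (Suc n)" using n by (auto intro: mono_onD)
      then show "\<delta> \<le> (1 - \<alpha> n) * (\<rho> n / lam) - lam * \<zeta> (n - 1)
          - (\<alpha> n * (1 + \<alpha> n) + \<alpha> n * (1 - \<alpha> n) * (\<rho> n / lam))"
        using gap[OF n] \<xi>_def[of n] n N0(1) by simp
    qed
    moreover have "lam * \<delta> / (2 * (2 - lam)) > 0" using lam' \<delta> by simp
    ultimately show ?thesis using that by blast
  qed
  \<comment> \<open>As \<open>\<rho> n / lam \<le> 2 / lam\<close>, the gap condition forces \<open>1 - \<alpha> n \<ge> \<delta> * lam / 2\<close>.\<close>
  define c where "c = \<delta> * lam / 2"
  have c: "c > 0" using \<delta> lam' by (simp add: c_def)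
  have \<alpha>_away: "\<alpha> n \<le> 1 - c" if n: "n \<ge> N0" for n
  proof -
    have "0 \<le> lam * \<zeta> (n - 1)" using lam' \<zeta>' by simp
    then have "\<delta> \<le> (1 - \<alpha> n) * (\<rho> n / lam)" using gap[OF n] \<xi>_nonneg[of "Suc n"] n by simp
    also have "\<dots> \<le> (1 - \<alpha> n) * (2 / lam)" using \<rho>_lam[OF n] \<alpha>'[of n] by (intro mult_left_mono) auto
    finally show ?thesis using lam' by (simp add: c_def field_simps)
  qed

  define Lyap where "Lyap z n = energy (x n - z) + 2 * lam * inner (x n - z) (u n)
      + lam * (1 + \<bar>1 - lam\<bar>) * \<zeta> (n - 1) * q (n - 1)" for z n
  have mono_z: "0 \<le> inner (p (Suc n) - z)
      (S (y n - p (Suc n)) - u (Suc n) + u n - \<gamma> n *\<^sub>R (C (y n) - C z))" if z: "z \<in> ?Z" for z n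
  proof -
    obtain b where b: "b \<in> A z" "0 = b + C z" using z unfolding zer_def sum_op_def single_def by blast
    have "b = - C z" using b(2) by (metis eq_neg_iff_add_eq_0)
    then have "0 \<le> inner (p (Suc n) - z) (a n - - C z)"
      using A a_mem[of n] b(1) unfolding maximally_monotone_op_def monotone_op_def by blast
    then have "0 \<le> inner (p (Suc n) - z) (\<gamma> n *\<^sub>R (a n - - C z))" using \<gamma>pos[of n] by simp
    also have "\<gamma> n *\<^sub>R (a n - - C z) = \<gamma> n *\<^sub>R a n + \<gamma> n *\<^sub>R C z" by (simp add: scaleR_add_right)
    also have "\<dots> = S (y n - p (Suc n)) - u (Suc n) + u n - \<gamma> n *\<^sub>R (C (y n) - C z)"
      unfolding a_eq by (simp add: scaleR_diff_right)
    finally show ?thesis .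
  qed
  have step: "Lyap z (Suc n) \<le> Lyap z n + \<alpha> n * (energy (x n - z) - energy (x (n - 1) - z))
      + \<xi> n * energy (x n - x (n - 1)) - \<eta> n * energy (x (Suc n) - x n)"
    if z: "z \<in> ?Z" and n: "n \<ge> N0" for z n
  proof -
    have n1: "n \<ge> 1" and Suc: "Suc (n - 1) = n" using n N0(1) by auto
    show ?thesis
      unfolding Lyap_def \<xi>_def[OF n1] \<eta>_def[OF n1] diff_Suc_1 q_def[of n]
    proof (rule lyapunov_step[OF mono_z[OF z] coco C(1) _ lam'(1) \<alpha>'(1) _ x_Suc \<zeta>'(1) q _ \<zeta>'(1) _
          \<nu>_cases[OF n1] \<rho>_def[OF n1] \<rho>_nonneg[OF n]])
      show "0 \<le> \<gamma> n" using \<gamma>pos[of n] by simp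
      show "y n = x n + \<alpha> n *\<^sub>R (x n - x (n - 1))" using y_Suc[of "n - 1"] unfolding Suc .
      show "dual_energy (u n) \<le> (\<zeta> (n - 1))\<^sup>2 * q (n - 1)" using dual_u[of "n - 1"] unfolding Suc .
      show "dual_energy (u (Suc n)) \<le> (\<zeta> n)\<^sup>2 * energy (y n - p (Suc n))"
        using dual_u[of n] unfolding q_def .
    qed
  qed
  have lower: "(\<alpha> n + \<kappa>) * energy (x n - z) \<le> Lyap z n" if n: "n \<ge> N0" for z n
  proof -
    have Suc: "Suc (n - 1) = n" using n N0(1) by auto
    have "(\<alpha> n + \<kappa>) * energy (x n - z)
        \<le> (1 - lam * \<zeta> (n - 1) / (1 + \<bar>1 - lam\<bar>)) * energy (x n - z)"
      using margin[OF n] by (intro mult_right_mono) auto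
    also have "\<dots> \<le> Lyap z n"
      unfolding Lyap_def
      by (rule lyapunov_lower_bound[OF \<zeta>'(1) q _ lam'(1)]) (use dual_u[of "n - 1"] Suc in simp)
    finally show ?thesis .
  qed

  \<comment> \<open>The Lyapunov inequality holds from index \<open>N0\<close> on.  The sequences below are shifted so that
    \<open>k = 0\<close> corresponds to \<open>n = N0\<close>; \<open>\<phi>\<close> is shifted by one less, since \<open>\<Theta>\<close> involves \<open>x (n - 1)\<close>.\<close>
  define \<phi> where "\<phi> z k = energy (x (k + (N0 - 1)) - z)" for z k
  define d where "d k = energy (x (k + N0) - x (k + (N0 - 1)))" for k
  have \<phi>_Suc: "\<phi> z (Suc k) = energy (x (k + N0) - z)" for z k
    using N0(1) by (simp add: \<phi>_def)
  have d_Suc: "d (Suc k) = energy (x (Suc (k + N0)) - x (k + N0))" for k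
    using N0(1) by (simp add: d_def)
  have pred: "k + N0 - 1 = k + (N0 - 1)" for k using N0(1) by simp
  have decrease: "Bseq (\<phi> z)" "d \<longlonglongrightarrow> 0"
      "convergent (\<lambda>k. Lyap z (k + N0) - \<alpha> (k + N0) * \<phi> z k + \<xi> (k + N0) * d k)"
    if z: "z \<in> ?Z" for z
  proof (atomize (full), intro conjI)
    note facts = inertial_lyapunov_decrease[where L = "\<lambda>k. Lyap z (k + N0)" and \<phi> = "\<phi> z"
        and d = d and \<alpha> = "\<lambda>k. \<alpha> (k + N0)" and \<xi> = "\<lambda>k. \<xi> (k + N0)"
        and \<eta> = "\<lambda>k. \<eta> (k + N0)" and \<kappa> = \<kappa> and \<delta> = \<delta>]
    have 1: "Lyap z (Suc k + N0) \<le> Lyap z (k + N0) + \<alpha> (k + N0) * (\<phi> z (Suc k) - \<phi> z k)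
        + \<xi> (k + N0) * d k - \<eta> (k + N0) * d (Suc k)" for k
      using step[OF z, of "k + N0"] unfolding \<phi>_Suc d_Suc pred by (simp add: \<phi>_def d_def)
    have 2: "(\<alpha> (k + N0) + \<kappa>) * \<phi> z (Suc k) \<le> Lyap z (k + N0)" for k
      unfolding \<phi>_Suc by (rule lower) simp
    have 3: "\<delta> \<le> \<eta> (k + N0) - \<xi> (Suc k + N0)" for k
      using bounds[of "k + N0"] by simp
    have 4: "0 \<le> \<phi> z k" "0 \<le> d k" "0 \<le> \<xi> (k + N0)" "\<alpha> (k + N0) \<le> \<alpha> (Suc k + N0)" for k
      using \<xi>_nonneg \<alpha>_mono by (auto simp: \<phi>_def d_def)
    show "Bseq (\<phi> z)" by (rule facts(1)[OF 1 2 \<kappa> 3 \<delta> 4(1,2,3) \<alpha>' 4(4)])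
    show "d \<longlonglongrightarrow> 0" by (rule facts(2)[OF 1 2 \<kappa> 3 \<delta> 4(1,2,3) \<alpha>' 4(4)])
    show "convergent (\<lambda>k. Lyap z (k + N0) - \<alpha> (k + N0) * \<phi> z k + \<xi> (k + N0) * d k)"
      by (rule facts(3)[OF 1 2 \<kappa> 3 \<delta> 4(1,2,3) \<alpha>' 4(4)])
  qed

  obtain z0 where z0: "z0 \<in> ?Z" using Z_nonempty by blast
  have bdd_diff: "bounded (range (\<lambda>n. x n - z))" if "z \<in> ?Z" for z
    using Bseq_offset[OF decrease(1)[OF that, unfolded \<phi>_def]] by (rule bounded_if_energy_bounded)
  have bdd_x: "bounded (range x)"
    using bounded_translation[OF bdd_diff[OF z0], of z0] by (simp add: image_image)

  have "(\<lambda>k. energy (x (Suc (k + (N0 - 1))) - x (k + (N0 - 1)))) \<longlonglongrightarrow> 0"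
    using decrease(2)[OF z0] N0(1) unfolding d_def by simp
  then have "(\<lambda>n. energy (x (Suc n) - x n)) \<longlonglongrightarrow> 0"
    by (rule LIMSEQ_offset[where a = 0 and f = "\<lambda>n. energy (x (Suc n) - x n)"])
  then have x_diff: "(\<lambda>n. x (Suc n) - x n) \<longlonglongrightarrow> 0" by (simp only: tendsto_zero_iff_energy)
  have "(\<lambda>n. \<alpha> (Suc n) *\<^sub>R (x (Suc n) - x n)) \<longlonglongrightarrow> 0"
    using \<alpha>' by (intro bounded_scaleR_tendsto_zero[where B = 1] x_diff) simp
  then have "(\<lambda>n. y (Suc n) - x (Suc n)) \<longlonglongrightarrow> 0" by (simp add: y_Suc)
  then have y_x: "(\<lambda>n. y n - x n) \<longlonglongrightarrow> 0" by (rule LIMSEQ_imp_Suc)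
  have "(\<lambda>n. (- (1 / lam)) *\<^sub>R ((x (Suc n) - x n) - (y n - x n))) \<longlonglongrightarrow> (- (1 / lam)) *\<^sub>R (0 - 0)"
    by (intro tendsto_intros x_diff y_x)
  moreover have "(- (1 / lam)) *\<^sub>R ((x (Suc n) - x n) - (y n - x n)) = y n - p (Suc n)" for n
  proof -
    have "(x (Suc n) - x n) - (y n - x n) = (- lam) *\<^sub>R (y n - p (Suc n))"
      unfolding x_Suc by (simp add: algebra_simps)
    then show ?thesis using lam'(1) by simp
  qed
  ultimately have y_p: "(\<lambda>n. y n - p (Suc n)) \<longlonglongrightarrow> 0" by simp
  then have q_lim: "q \<longlonglongrightarrow> 0" unfolding q_def tendsto_zero_iff_energy .
  obtain B where B: "B > 0" "\<And>v. (norm v)\<^sup>2 \<le> B * dual_energy v"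
    using norm_squared_le_dual_energy by blast
  have "norm ((norm (u (Suc n)))\<^sup>2) \<le> B * q n" for n
  proof -
    have "(\<zeta> n)\<^sup>2 * q n \<le> 1 * q n" using \<zeta>'[of n] q by (intro mult_right_mono) (auto simp: power_le_one)
    then have "dual_energy (u (Suc n)) \<le> q n" using dual_u[of n] by linarith
    then have "B * dual_energy (u (Suc n)) \<le> B * q n" using B(1) by (intro mult_left_mono) auto
    then show ?thesis using B(2)[of "u (Suc n)"] by simp
  qed
  moreover have "(\<lambda>n. B * q n) \<longlonglongrightarrow> 0" by (intro tendsto_mult_right_zero q_lim)
  ultimately have "(\<lambda>n. (norm (u (Suc n)))\<^sup>2) \<longlonglongrightarrow> 0"
    by (intro Lim_null_comparison[of "\<lambda>n. (norm (u (Suc n)))\<^sup>2" "\<lambda>n. B * q n"]) auto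
  then have u_Suc_lim: "(\<lambda>n. u (Suc n)) \<longlonglongrightarrow> 0"
    by (simp add: power_tendsto_0_iff tendsto_norm_zero_iff)
  then have u_lim: "u \<longlonglongrightarrow> 0" by (rule LIMSEQ_imp_Suc)

  have conv_x: "convergent (\<lambda>n. energy (x n - z))" if z: "z \<in> ?Z" for z
  proof -
    have "convergent (\<phi> z)"
    proof (rule inertial_sequence_convergent[OF decrease(3)[OF z] _ _ _ decrease(2)[OF z]])
      have "(\<lambda>n. \<zeta> (Suc n - 1) *\<^sub>R q (Suc n - 1)) \<longlonglongrightarrow> 0"
        using \<zeta>' q_lim by (intro bounded_scaleR_tendsto_zero[where B = 1]) auto
      then have "(\<lambda>n. \<zeta> (n - 1) *\<^sub>R q (n - 1)) \<longlonglongrightarrow> 0"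
        by (rule LIMSEQ_imp_Suc)
      then have "(\<lambda>n. 2 * lam * inner (x n - z) (u n)
          + lam * (1 + \<bar>1 - lam\<bar>) * (\<zeta> (n - 1) *\<^sub>R q (n - 1))) \<longlonglongrightarrow> 2 * lam * 0 + lam * (1 + \<bar>1 - lam\<bar>) * 0"
        by (intro tendsto_add tendsto_mult_left inner_tendsto_zero_bounded bdd_diff[OF z] u_lim)
      then have "(\<lambda>n. Lyap z n - energy (x n - z)) \<longlonglongrightarrow> 0"
        by (simp add: Lyap_def mult.assoc)
      then show "(\<lambda>k. Lyap z (k + N0) - \<phi> z (Suc k)) \<longlonglongrightarrow> 0"
        unfolding \<phi>_Suc by (rule LIMSEQ_ignore_initial_segment)
      have "(\<lambda>n. energy (x n - z + (x (Suc n) - x n)) - energy (x n - z)) \<longlonglongrightarrow> 0"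
        by (rule energy_perturbation[OF bdd_diff[OF z] x_diff])
      then have "(\<lambda>n. energy (x (Suc n) - z) - energy (x n - z)) \<longlonglongrightarrow> 0"
        by (simp add: algebra_simps)
      then show "(\<lambda>k. \<phi> z (Suc k) - \<phi> z k) \<longlonglongrightarrow> 0"
        unfolding \<phi>_def add_Suc by (rule LIMSEQ_ignore_initial_segment)
      show "\<bar>\<xi> (k + N0)\<bar> \<le> 2 + 2 / lam" for k
        using \<xi>_nonneg[of "k + N0"] \<xi>_upper[of "k + N0"] by simp
      show "\<alpha> (k + N0) \<le> \<alpha> (Suc k + N0)" for k using \<alpha>_mono[of "k + N0"] by simp
      show "\<alpha> (k + N0) \<le> 1 - c" for k by (rule \<alpha>_away) simp
      show "c > 0" by (rule c)
    qed
    then obtain l where "\<phi> z \<longlonglongrightarrow> l" by (auto simp: convergent_def)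
    then have "(\<lambda>n. energy (x n - z)) \<longlonglongrightarrow> l" unfolding \<phi>_def by (rule LIMSEQ_offset)
    then show ?thesis by (auto simp: convergent_def)
  qed

  \<comment> \<open>The sequence \<open>p\<close> carries the inclusions in \<open>A\<close> and is asymptotic to \<open>x\<close>.\<close>
  define P where "P n = p (Suc n)" for n
  have "(\<lambda>n. (y n - x n) - (y n - p (Suc n))) \<longlonglongrightarrow> 0 - 0" by (intro tendsto_diff y_x y_p)
  then have P_x: "(\<lambda>n. P n - x n) \<longlonglongrightarrow> 0" by (simp add: P_def)
  have "bounded (range (\<lambda>n. x n + (P n - x n)))"
    using bdd_x convergent_imp_bounded[OF P_x] by (rule bounded_plus_comp)
  then have bdd_P: "bounded (range P)" by simp
  have conv_P: "convergent (\<lambda>n. energy (P n - z))" if z: "z \<in> ?Z" for z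
  proof -
    obtain l where l: "(\<lambda>n. energy (x n - z)) \<longlonglongrightarrow> l" using conv_x[OF z] by (auto simp: convergent_def)
    have "(\<lambda>n. (energy (x n - z + (P n - x n)) - energy (x n - z)) + energy (x n - z)) \<longlonglongrightarrow> 0 + l"
      by (intro tendsto_add energy_perturbation bdd_diff[OF z] P_x l)
    then show ?thesis by (auto simp: convergent_def)
  qed

  have coco_norm: "\<mu> / B * (norm (C v - C w))\<^sup>2 \<le> inner (v - w) (C v - C w)" for v w
  proof -
    have "\<mu> / B * (norm (C v - C w))\<^sup>2 \<le> \<mu> / B * (B * dual_energy (C v - C w))"
      using B C(1) by (intro mult_left_mono) auto
    also have "\<dots> \<le> inner (v - w) (C v - C w)" using coco[of v w] B(1) by simp
    finally show ?thesis .
  qed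
  have C_lim: "(\<lambda>n. C (P n) - C (y n)) \<longlonglongrightarrow> 0"
  proof (rule Lim_null_comparison)
    have "norm (C (P n) - C (y n)) \<le> B / \<mu> * norm (P n - y n)" for n
    proof (cases "norm (C (P n) - C (y n)) = 0")
      case False
      have "\<mu> / B * (norm (C (P n) - C (y n)))\<^sup>2 \<le> norm (P n - y n) * norm (C (P n) - C (y n))"
        using coco_norm[of "P n" "y n"] norm_cauchy_schwarz[of "P n - y n" "C (P n) - C (y n)"] by linarith
      then have "(\<mu> / B * norm (C (P n) - C (y n))) * norm (C (P n) - C (y n))
          \<le> norm (P n - y n) * norm (C (P n) - C (y n))"
        by (simp add: power2_eq_square)
      then have "\<mu> / B * norm (C (P n) - C (y n)) \<le> norm (P n - y n)"
        by (rule mult_right_le_imp_le) (use False in simp)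
      then show ?thesis using B(1) C(1) by (simp add: field_simps)
    qed (use B(1) C(1) in simp)
    then show "\<forall>\<^sub>F n in sequentially. norm (C (P n) - C (y n)) \<le> B / \<mu> * norm (P n - y n)" by simp
    have "(\<lambda>n. P n - y n) \<longlonglongrightarrow> 0" using tendsto_minus[OF y_p] by (simp add: P_def)
    then show "(\<lambda>n. B / \<mu> * norm (P n - y n)) \<longlonglongrightarrow> 0"
      by (intro tendsto_mult_right_zero tendsto_norm_zero)
  qed
  have "(\<lambda>n. S (y n - p (Suc n)) - u (Suc n) + u n) \<longlonglongrightarrow> S 0 - 0 + 0"
    by (intro tendsto_add tendsto_diff S.tendsto y_p u_Suc_lim u_lim)
  then have "(\<lambda>n. S (y n - p (Suc n)) - u (Suc n) + u n) \<longlonglongrightarrow> 0" by simp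
  moreover have "\<bar>1 / \<gamma> n\<bar> \<le> 1 / \<gamma>_low" for n
    using \<gamma>(1) \<gamma>(3)[of n] \<gamma>pos[of n] by (simp add: frac_le)
  ultimately have "(\<lambda>n. (1 / \<gamma> n) *\<^sub>R (S (y n - p (Suc n)) - u (Suc n) + u n)) \<longlonglongrightarrow> 0"
    by (intro bounded_scaleR_tendsto_zero[where B = "1 / \<gamma>_low"]) auto
  then have "(\<lambda>n. (1 / \<gamma> n) *\<^sub>R (S (y n - p (Suc n)) - u (Suc n) + u n) + (C (P n) - C (y n)))
      \<longlonglongrightarrow> 0 + 0"
    by (intro tendsto_add C_lim)
  moreover have "(1 / \<gamma> n) *\<^sub>R (S (y n - p (Suc n)) - u (Suc n) + u n) + (C (P n) - C (y n))
      = a n + C (P n)" for n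
  proof -
    have "S (y n - p (Suc n)) - u (Suc n) + u n = \<gamma> n *\<^sub>R (a n + C (y n))"
      using a_eq[of n] by (simp add: scaleR_add_right)
    then show ?thesis using \<gamma>pos[of n] by simp
  qed
  ultimately have residual: "(\<lambda>n. a n + C (P n)) \<longlonglongrightarrow> 0" by simp

  have "tail_hull_core P UNIV \<subseteq> ?Z"
  proof (rule tail_hull_core_zer_sum[OF A _ coco_norm z0 _ residual bdd_P])
    show "\<mu> / B > 0" using B(1) C(1) by simp
    show "a n \<in> A (P n)" for n unfolding P_def by (rule a_mem)
  qed
  from opial_tail_hull_core[OF conv_P this bdd_P]
  obtain z where z: "z \<in> ?Z" "weakly_converges_to P z" by blast
  have "(\<lambda>n. inner (x n) v) \<longlonglongrightarrow> inner z v" for v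
  proof -
    have "(\<lambda>n. inner (P n) v - inner (P n - x n) v) \<longlonglongrightarrow> inner z v - inner 0 v"
      using z(2) unfolding weakly_converges_to_def
      by (intro tendsto_diff tendsto_inner[OF P_x tendsto_const]) simp
    then show ?thesis by (simp add: inner_diff_left)
  qed
  then show ?thesis using z(1) unfolding weakly_converges_to_def by blast
qed

end
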